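(* Let $r\le s$, and let $\hat{\mathbf\Gamma}_{\mathrm{pos}}^{\mathrm{OLR}}\in\mathbb{R}^{s\times s}$ and $\hat{\boldsymbol\mu}_{\mathrm{pos}}^{\mathrm{OLR}}\in\mathbb{R}^s$ be the rank-$r$ optimal low-rank (OLR) posterior covariance and mean approximations (defined in the context) for the $s$-dimensional restricted Bayesian inverse problem $\mathbf m=\hat{\mathbf G}\hat{\mathbf p}+\boldsymbol\epsilon$, $\hat{\mathbf p}\sim\mathcal N(\mathbf 0,\hat{\mathbf\Gamma}_{\mathrm{pr}})$, $\boldsymbol\epsilon\sim\mathcal N(\mathbf 0,\mathbf\Gamma_{\mathrm{obs}})$. These approximations optimally approximate the restricted posterior statistics $\hat{\mathbf\Gamma}_{\mathrm{pos}},\hat{\boldsymbol\mu}_{\mathrm{pos}}$ in the sense that $$\hat{\mathbf\Gamma}_{\mathrm{pos}}^{\mathrm{OLR}}=\arg\min_{\hat{\mathbf\Gamma}\in\widehat{\mathcal M}_r} d_{\mathcal F}^2(\hat{\mathbf\Gamma}_{\mathrm{pos}},\hat{\mathbf\Gamma})\qquad\text{and}\qquad \hat{\boldsymbol\mu}_{\mathrm{pos}}^{\mathrm{OLR}}=\arg\min_{\hat{\boldsymbol\mu}\in\hat{\mathcal A}_r}\mathbb E\,\|\hat{\boldsymbol\mu}_{\mathrm{pos}}-\hat{\boldsymbol\mu}\|^2_{\hat{\mathbf\Gamma}_{\mathrm{pos}}^{-1}},$$ where $\widehat{\mathcal M}_r=\{\hat{\mathbf\Gamma}_{\mathrm{pr}}-\hat{\mathbf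 K}_r\hat{\mathbf K}_r^\top\succ 0:\ \mathrm{rank}(\hat{\mathbf K}_r)\le r\}$ and $\hat{\mathcal A}_r=\{\hat{\mathbf A}_r\mathbf m\in\mathbb R^s:\ \mathrm{rank}(\hat{\mathbf A}_r)\le r\}$.
   Context: **Inverse problem.** Let $\mathbf G\in\mathbb R^{d_{\mathrm{obs}}\times d}$, $\mathbf m=\mathbf G\mathbf p+\boldsymbol\epsilon$, with independent $\mathbf p\sim\mathcal N(\mathbf 0,\mathbf\Gamma_{\mathrm{pr}})$ and $\boldsymbol\epsilon\sim\mathcal N(\mathbf 0,\mathbf\Gamma_{\mathrm{obs}})$. Here $\mathbf\Gamma_{\mathrm{obs}}$ is symmetric positive definite, and $\mathbf\Gamma_{\mathrm{pr}}\in\mathbb R^{d\times d}$ is symmetric positive semidefinite of rank $s<d$. Put $\mathbf P=\mathbf\Gamma_{\mathrm{pr}}$ and $\mathbf Q=\mathbf G^\top\mathbf\Gamma_{\mathrm{obs}}^{-1}\mathbf G$; $\mathbf Q$ is assumed to have full rank. **Bases (square-root balancing).** Write $\mathbf P=\mathbf L\mathbf L^\top$ with $\mathbf L\in\mathbb R^{d\times s}$ and $\mathbf Q=\mathbf R\mathbf R^\top$. Let $\mathbf R^\top\mathbf L=\mathbf U_s\mathbf\Sigma_s\mathbf Z_s^\top$ be a (thin) singular value decomposition with $\mathbf\Sigma_s=\mathrm{diag}(\sigma_1,\dots,\sigma_s)$, $\sigma_1\ge\dots\ge\sigma_s>0$. Define $\mathbf W_s=\mathbf L\mathbf Z_s\mathbf\Sigma_s^{-1/2}$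 and $\mathbf V_s=\mathbf R\mathbf U_s\mathbf\Sigma_s^{-1/2}$, both in $\mathbb R^{d\times s}$. Their columns are right eigenvectors of $\mathbf P\mathbf Q$, respectively of $\mathbf Q\mathbf P$, for the nonzero eigenvalues $\sigma_i^2$, normalized so that $\mathbf V_s^\top\mathbf W_s=\mathbf I_s$ and $\mathbf V_s^\top\mathbf P\mathbf V_s=\mathbf\Sigma_s=\mathbf W_s^\top\mathbf Q\mathbf W_s$. **Restricted problem.** Set $\hat{\mathbf G}=\mathbf G\mathbf W_s\in\mathbb R^{d_{\mathrm{obs}}\times s}$, $\hat{\mathbf p}=\mathbf V_s^\top\mathbf p$, and $\hat{\mathbf\Gamma}_{\mathrm{pr}}=\mathbf V_s^\top\mathbf\Gamma_{\mathrm{pr}}\mathbf V_s=\mathbf\Sigma_s$. The restricted measurement model is $\mathbf m=\hat{\mathbf G}\hat{\mathbf p}+\boldsymbol\epsilon$ with $\hat{\mathbf p}\sim\mathcal N(\mathbf 0,\hat{\mathbf\Gamma}_{\mathrm{pr}})$. Its posterior is $\mathcal N(\hat{\boldsymbol\mu}_{\mathrm{pos}},\hat{\mathbf\Gamma}_{\mathrm{pos}})$ with $\hat{\mathbf\Gamma}_{\mathrm{pos}}=(\hat{\mathbf\Gamma}_{\mathrm{pr}}^{-1}+\hat{\mathbf G}^\top\mathbf\Gamma_{\mathrm{obs}}^{-1}\hat{\mathbf G})^{-1}$ and $\hat{\boldsymbol\mu}_{\mathrm{pos}}=\hat{\mathbf\Gamma}_{\mathrm{pos}}\hat{\mathbf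 G}^\top\mathbf\Gamma_{\mathrm{obs}}^{-1}\mathbf m$. **OLR approximations of the restricted problem.** Let $\hat{\mathbf W}\in\mathbb R^{s\times s}$ collect generalized eigenvectors, $\hat{\mathbf G}^\top\mathbf\Gamma_{\mathrm{obs}}^{-1}\hat{\mathbf G}\hat{\mathbf W}=\hat{\mathbf\Gamma}_{\mathrm{pr}}^{-1}\hat{\mathbf W}\hat{\mathbf\Sigma}^2$, with eigenvalues (the diagonal of $\hat{\mathbf\Sigma}^2$) in non-increasing order and normalization $\hat{\mathbf W}^\top\hat{\mathbf G}^\top\mathbf\Gamma_{\mathrm{obs}}^{-1}\hat{\mathbf G}\hat{\mathbf W}=\hat{\mathbf\Sigma}$. Let $\hat{\mathbf V}=\hat{\mathbf G}^\top\mathbf\Gamma_{\mathrm{obs}}^{-1}\hat{\mathbf G}\hat{\mathbf W}\hat{\mathbf\Sigma}^{-1}$, let $\hat{\mathbf W}_r,\hat{\mathbf V}_r$ be the first $r$ columns, and set $\hat{\mathbf G}_{\mathrm{OLR}}=\hat{\mathbf G}\hat{\mathbf W}_r\hat{\mathbf V}_r^\top$. Then $$\hat{\mathbf\Gamma}_{\mathrm{pos}}^{\mathrm{OLR}}=(\hat{\mathbf\Gamma}_{\mathrm{pr}}^{-1}+\hat{\mathbf G}_{\mathrm{OLR}}^\top\mathbf\Gamma_{\mathrm{obs}}^{-1}\hat{\mathbf G}_{\mathrm{OLR}})^{-1},\qquad \hat{\boldsymbol\mu}_{\mathrm{pos}}^{\mathrm{OLR}}=\hat{\mathbf\Gamma}_{\mathrm{pos}}^{\mathrm{OLR}}\hat{\mathbf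 G}_{\mathrm{OLR}}^\top\mathbf\Gamma_{\mathrm{obs}}^{-1}\mathbf m.$$ **Metrics.** For symmetric positive definite $\mathbf E,\mathbf F$, the Förstner distance is $d_{\mathcal F}^2(\mathbf E,\mathbf F)=\sum_i\ln^2(\lambda_i)$, with $\lambda_i$ the generalized eigenvalues of the pencil $(\mathbf E,\mathbf F)$. For symmetric positive definite $\mathbf M$, $\|\mathbf x\|_{\mathbf M}^2=\mathbf x^\top\mathbf M\mathbf x$. The expectation is over the joint distribution of parameter and data (so $\mathbf m\sim\mathcal N(\mathbf 0,\hat{\mathbf G}\hat{\mathbf\Gamma}_{\mathrm{pr}}\hat{\mathbf G}^\top+\mathbf\Gamma_{\mathrm{obs}})$). In the class $\hat{\mathcal A}_r$, $\hat{\mathbf A}_r\in\mathbb R^{s\times d_{\mathrm{obs}}}$ is a fixed matrix. "$=\arg\min$" means that the left-hand side is a minimizer over the class. *)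

theory Defs
  imports "HOL-Probability.Probability" "HOL-Computational_Algebra.Polynomial"
begin

definition pos_semidef :: "real^'n^'n \<Rightarrow> bool" where
  "pos_semidef A \<longleftrightarrow> transpose A = A \<and> (\<forall>x. 0 \<le> x \<bullet> (A *v x))"

definition pos_def :: "real^'n^'n \<Rightarrow> bool" where
  "pos_def A \<longleftrightarrow> transpose A = A \<and> (\<forall>x. x \<noteq> 0 \<longrightarrow> 0 < x \<bullet> (A *v x))"

definition diag_matrix :: "real^'n \<Rightarrow> real^'n^'n" where
  "diag_matrix v = (\<chi> i j. if i = j then v $ i else 0)"

text \<open>
  Columns are ordered by the linear order on their index type. \<open>first_columns r A\<close> keeps the first
  \<open>r\<close> columns of \<open>A\<close> and pads them with zero columns, so that \<open>r\<close> can be an ordinary natural number;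
  the padding does not change products \<open>first_columns r A ** transpose (first_columns r B)\<close>.
\<close>
definition first_columns ::
  "nat \<Rightarrow> real^('n::{finite,linorder})^'m \<Rightarrow> real^('n::{finite,linorder})^'m" where
  "first_columns r A = (\<chi> i j. if card {k. k < j} < r then A $ i $ j else 0)"

text \<open>
  Centred, possibly degenerate, Gaussian law: every linear functional \<open>t \<bullet> X\<close> has the univariate
  normal law with mean 0 and variance \<open>t \<bullet> (C *v t)\<close>, a point mass at 0 if this variance vanishes.
\<close>
definition gaussian_vector :: "'w measure \<Rightarrow> ('w \<Rightarrow> real^'n) \<Rightarrow> real^'n^'n \<Rightarrow> bool" where
  "gaussian_vector M X C \<longleftrightarrow>
     X \<in> borel_measurable M \<and> pos_semidef C \<and>
     (\<forall>t. if t \<bullet> (C *v t) = 0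
          then (AE \<omega> in M. t \<bullet> X \<omega> = 0)
          else distributed M lborel (\<lambda>\<omega>. t \<bullet> X \<omega>) (normal_density 0 (sqrt (t \<bullet> (C *v t)))))"

text \<open>
  The library's \<open>indep_var\<close> requires both variables to have the same type; this is its
  characterization by generated sigma-algebras, for vectors of different dimensions.
\<close>
definition indep_vectors :: "'w measure \<Rightarrow> ('w \<Rightarrow> real^'m) \<Rightarrow> ('w \<Rightarrow> real^'n) \<Rightarrow> bool" where
  "indep_vectors M X Y \<longleftrightarrow>
     X \<in> borel_measurable M \<and> Y \<in> borel_measurable M \<and>
     prob_space.indep_set M
       (sets (vimage_algebra (space M) X borel)) (sets (vimage_algebra (space M) Y borel))"

text \<open>\<open>A = U ** diag_matrix \<sigma> ** transpose Z\<close> is a thin singular value decomposition of a matrix of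
  full column rank.\<close>
definition thin_svd ::
  "real^('s::{finite,linorder})^'k \<Rightarrow> real^('s::{finite,linorder})^'k \<Rightarrow>
   real^('s::{finite,linorder}) \<Rightarrow> real^('s::{finite,linorder})^('s::{finite,linorder}) \<Rightarrow>
   bool" where
  "thin_svd A U \<sigma> Z \<longleftrightarrow>
     A = U ** diag_matrix \<sigma> ** transpose Z \<and>
     transpose U ** U = mat 1 \<and> transpose Z ** Z = mat 1 \<and>
     (\<forall>i. 0 < \<sigma> $ i) \<and> (\<forall>i j. i \<le> j \<longrightarrow> \<sigma> $ j \<le> \<sigma> $ i)"

definition inv_sqrt_diag :: "real^'n \<Rightarrow> real^'n^'n" where
  "inv_sqrt_diag \<sigma> = diag_matrix (\<chi> i. 1 / sqrt (\<sigma> $ i))"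

definition posterior_cov :: "real^'n^'n \<Rightarrow> real^'n^'o \<Rightarrow> real^'o^'o \<Rightarrow> real^'n^'n" where
  "posterior_cov \<Gamma>pr G \<Gamma>obs =
     matrix_inv (matrix_inv \<Gamma>pr + transpose G ** matrix_inv \<Gamma>obs ** G)"

definition posterior_mean ::
  "real^'n^'n \<Rightarrow> real^'n^'o \<Rightarrow> real^'o^'o \<Rightarrow> real^'o \<Rightarrow> real^'n" where
  "posterior_mean \<Gamma>pr G \<Gamma>obs m =
     (posterior_cov \<Gamma>pr G \<Gamma>obs ** transpose G ** matrix_inv \<Gamma>obs) *v m"

text \<open>
  The columns of \<open>W\<close> are generalized eigenvectors (hence nonzero) of the pencil
  \<open>(H, matrix_inv \<Gamma>pr)\<close> for the eigenvalues \<open>(\<sigma> $ i)\<^sup>2\<close>, where \<open>H = transpose G ** matrix_inv \<Gamma>obs ** G\<close>.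
\<close>
definition olr_eigenbasis ::
  "real^('s::{finite,linorder})^('s::{finite,linorder}) \<Rightarrow> real^('s::{finite,linorder})^'o \<Rightarrow>
   real^'o^'o \<Rightarrow> real^('s::{finite,linorder})^('s::{finite,linorder}) \<Rightarrow>
   real^('s::{finite,linorder}) \<Rightarrow> bool" where
  "olr_eigenbasis \<Gamma>pr G \<Gamma>obs W \<sigma> \<longleftrightarrow>
     (let H = transpose G ** matrix_inv \<Gamma>obs ** G in
       (\<forall>i. column i W \<noteq> 0) \<and>
       H ** W = matrix_inv \<Gamma>pr ** W ** (diag_matrix \<sigma> ** diag_matrix \<sigma>) \<and>
       (\<forall>i j. i \<le> j \<longrightarrow> (\<sigma> $ j)\<^sup>2 \<le> (\<sigma> $ i)\<^sup>2) \<and>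
       transpose W ** H ** W = diag_matrix \<sigma>)"

definition olr_forward ::
  "nat \<Rightarrow> real^('s::{finite,linorder})^'o \<Rightarrow> real^'o^'o \<Rightarrow>
   real^('s::{finite,linorder})^('s::{finite,linorder}) \<Rightarrow> real^('s::{finite,linorder}) \<Rightarrow>
   real^('s::{finite,linorder})^'o" where
  "olr_forward r G \<Gamma>obs W \<sigma> =
     (let V = transpose G ** matrix_inv \<Gamma>obs ** G ** W ** matrix_inv (diag_matrix \<sigma>) in
       G ** first_columns r W ** transpose (first_columns r V))"

text \<open>
  The polynomial \<open>x \<mapsto> det (E - x F)\<close>. Its roots, with multiplicity, are the generalized eigenvalues of
  the pencil \<open>(E, F)\<close>; for positive definite \<open>E\<close> and \<open>F\<close> they are all real and positive.
\<close>
definition pencil_poly :: "real^'n^'n \<Rightarrow> real^'n^'n \<Rightarrow> real poly" where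
  "pencil_poly E F = det (\<chi> i j. [:E $ i $ j, - (F $ i $ j):])"

definition foerstner_dist_sq :: "real^'n^'n \<Rightarrow> real^'n^'n \<Rightarrow> real" where
  "foerstner_dist_sq E F = (\<Sum>x\<in>#proots (pencil_poly E F). (ln x)\<^sup>2)"

definition weighted_norm_sq :: "real^'n^'n \<Rightarrow> real^'n \<Rightarrow> real" where
  "weighted_norm_sq A x = x \<bullet> (A *v x)"

text \<open>
  The factor \<open>K\<close> is taken square. This loses nothing: a factor with any number of columns has the
  same product \<open>K ** transpose K\<close> as some square factor of the same rank.
\<close>
definition cov_class :: "nat \<Rightarrow> real^'n^'n \<Rightarrow> (real^'n^'n) set" where
  "cov_class r \<Gamma>pr =
     {\<Gamma>pr - K ** transpose K | K :: real^'n^'n.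
        rank K \<le> r \<and> pos_def (\<Gamma>pr - K ** transpose K)}"

definition mean_class :: "nat \<Rightarrow> ('w \<Rightarrow> real^'o) \<Rightarrow> ('w \<Rightarrow> real^'n) set" where
  "mean_class r m = {\<lambda>\<omega>. A *v m \<omega> | A :: real^'o^'n. rank A \<le> r}"

end

theory Submission
  imports Defs
begin

text \<open>
  In the restricted problem, write \<open>C\<close> for the prior covariance, \<open>G\<close> for the forward matrix, \<open>W\<close> for the
  eigenbasis, \<open>\<Gamma>\<close> for the noise covariance, \<open>H = transpose G ** matrix_inv \<Gamma> ** G\<close>, \<open>D = diag_matrix d\<close>
  for the OLR eigenvalues and \<open>V = transpose (matrix_inv W)\<close>. The eigenbasis diagonalizes everything at
  once: \<open>C = W ** D ** transpose W\<close> and \<open>H = V ** D ** transpose V\<close>. With \<open>S\<close> the set of the first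
  \<open>r\<close> indices, both minimization problems become diagonal.

  Covariance: the Foerstner distance is invariant under congruence, so one compares \<open>diag_matrix a\<close>,
  \<open>a\<^sub>i = 1 / (1 + d\<^sub>i\<^sup>2) < 1\<close>, with \<open>B = I - K K\<^sup>T\<close>. Since \<open>B\<close> is the identity form on the kernel of
  \<open>K\<^sup>T\<close>, whose codimension is at most \<open>r\<close>, a dimension count shows that at least
  \<open>card {i. a\<^sub>i \<le> t} - r\<close> pencil eigenvalues are \<open>\<le> t\<close>. As all \<open>a\<^sub>i < 1\<close>, this bounds
  the distance from below by the sum of \<open>ln\<^sup>2 a\<^sub>i\<close> over \<open>i \<notin> S\<close>, which the OLR covariance attains.

  Mean: after whitening, the error is \<open>E |F m - B m|\<^sup>2\<close> where \<open>F m\<close> has covariance \<open>D\<^sup>2\<close> and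
  \<open>rank B \<le> r\<close>. Projecting onto the orthogonal complement of the range of \<open>B\<close> removes \<open>B m\<close> and
  leaves a sum of \<open>c\<^sub>i d\<^sub>i\<^sup>2\<close> with \<open>0 \<le> c\<^sub>i \<le> 1\<close> and total weight at least \<open>CARD('s) - r\<close>, hence
  at least the sum of \<open>d\<^sub>i\<^sup>2\<close> over \<open>i \<notin> S\<close>.
\<close>

section \<open>Linear algebra\<close>

lemma transpose_mult_inner: "(A *v x) \<bullet> y = x \<bullet> (transpose A *v y)" for A :: "real^'n^'m"
  by (metis dot_lmul_matrix inner_commute transpose_matrix_vector)

lemma matrix_add_rdistrib: "(A + B) ** C = A ** C + B ** C" for A B :: "'a::semiring_1^'n^'m"
  by (simp add: vec_eq_iff matrix_matrix_mult_def distrib_right sum.distrib)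

lemma matrix_diff_ldistrib: "A ** (B - C) = A ** B - A ** C" for A :: "real^'n^'m"
  by (simp add: vec_eq_iff matrix_matrix_mult_def right_diff_distrib sum_subtractf)

lemma matrix_diff_rdistrib: "(A - B) ** C = A ** C - B ** C" for A :: "real^'n^'m"
  by (simp add: vec_eq_iff matrix_matrix_mult_def left_diff_distrib sum_subtractf)

text \<open>\<open>matrix_inv\<close> is a choice, so it has no properties until some two-sided
  inverse is exhibited. For square matrices over a field one product being \<open>mat 1\<close>
  suffices; later inverses are found by naming a candidate \<open>B\<close>.\<close>

lemma matrix_inv_unique:
  fixes A B :: "'a::field^'n^'n"
  assumes "A ** B = mat 1"
  shows "matrix_inv A = B"
proof -
  have BA: "B ** A = mat 1"
    using assms matrix_left_right_inverse by blast
  have "A ** matrix_inv A = mat 1 \<and> matrix_inv A ** A = mat 1"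
    unfolding matrix_inv_def by (rule someI[of _ B]) (use assms BA in auto)
  then show ?thesis
    by (metis BA matrix_mul_assoc matrix_mul_lid matrix_mul_rid)
qed

lemma matrix_inv_inverse:
  fixes A :: "'a::field^'n^'n"
  assumes "invertible A"
  shows "A ** matrix_inv A = mat 1" "matrix_inv A ** A = mat 1"
  using assms matrix_inv_unique unfolding invertible_def by metis+

lemma invertible_matrix_inv:
  "invertible A \<Longrightarrow> invertible (matrix_inv A)" for A :: "'a::field^'n^'n"
  using matrix_inv_inverse invertible_def by blast

lemma matrix_inv_matrix_inv:
  "invertible A \<Longrightarrow> matrix_inv (matrix_inv A) = A" for A :: "'a::field^'n^'n"
  by (simp add: matrix_inv_inverse matrix_inv_unique)

lemma matrix_inv_mult:
  fixes A B :: "'a::field^'n^'n"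
  assumes "invertible A" "invertible B"
  shows "matrix_inv (A ** B) = matrix_inv B ** matrix_inv A"
proof (rule matrix_inv_unique)
  have "A ** B ** (matrix_inv B ** matrix_inv A) = A ** (B ** matrix_inv B) ** matrix_inv A"
    by (simp add: matrix_mul_assoc)
  then show "A ** B ** (matrix_inv B ** matrix_inv A) = mat 1"
    by (simp add: assms matrix_inv_inverse)
qed

lemma matrix_inv_transpose:
  fixes A :: "'a::field^'n^'n"
  assumes "invertible A"
  shows "matrix_inv (transpose A) = transpose (matrix_inv A)"
  by (rule matrix_inv_unique) (metis assms matrix_inv_inverse(2) matrix_transpose_mul transpose_mat)

section \<open>Calculus of diagonal matrices\<close>

lemma diag_matrix_nth [simp]: "diag_matrix a $ i $ j = (if i = j then a $ i else 0)"
  by (simp add: diag_matrix_def)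

lemma diag_matrix_mult_left_nth: "(diag_matrix a ** A) $ i $ j = a $ i * A $ i $ j"
  by (simp add: matrix_matrix_mult_def if_distrib if_distribR cong: if_cong)

lemma diag_matrix_mult_right_nth: "(A ** diag_matrix a) $ i $ j = A $ i $ j * a $ j"
  by (simp add: matrix_matrix_mult_def if_distrib if_distribR cong: if_cong)

lemma diag_matrix_mult: "diag_matrix a ** diag_matrix b = diag_matrix (\<chi> i. a $ i * b $ i)"
  by (simp add: vec_eq_iff diag_matrix_mult_left_nth)

lemma diag_matrix_vector_mult: "diag_matrix a *v x = (\<chi> i. a $ i * x $ i)"
  by (simp add: matrix_vector_mult_def vec_eq_iff if_distrib if_distribR cong: if_cong)

lemma transpose_diag_matrix [simp]: "transpose (diag_matrix a) = diag_matrix a"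
  by (simp add: transpose_def vec_eq_iff)

lemma diag_matrix_1: "diag_matrix (\<chi> i. 1) = mat 1"
  by (simp add: vec_eq_iff mat_def)

lemma diag_matrix_add: "diag_matrix a + diag_matrix b = diag_matrix (\<chi> i. a $ i + b $ i)"
  by (simp add: vec_eq_iff)

lemma diag_matrix_diff: "diag_matrix a - diag_matrix b = diag_matrix (\<chi> i. a $ i - b $ i)"
  by (simp add: vec_eq_iff)

lemma inner_diag_matrix: "x \<bullet> (diag_matrix a *v x) = (\<Sum>i\<in>UNIV. a $ i * (x $ i)\<^sup>2)"
  by (simp add: diag_matrix_vector_mult inner_vec_def power2_eq_square ac_simps)

lemma invertible_diag_matrix: "(\<And>i. a $ i \<noteq> 0) \<Longrightarrow> invertible (diag_matrix a)"
  unfolding invertible_def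
  by (rule exI[of _ "diag_matrix (\<chi> i. 1 / a $ i)"])
    (simp add: diag_matrix_mult flip: diag_matrix_1)

lemma matrix_inv_diag_matrix:
  "(\<And>i. a $ i \<noteq> 0) \<Longrightarrow> matrix_inv (diag_matrix a) = diag_matrix (\<chi> i. 1 / a $ i)"
  by (rule matrix_inv_unique) (simp add: diag_matrix_mult flip: diag_matrix_1)

section \<open>Positive definiteness and congruence\<close>

lemma pos_def_diag_matrix: "pos_def (diag_matrix a) \<longleftrightarrow> (\<forall>i. 0 < a $ i)"
proof
  assume "pos_def (diag_matrix a)"
  then have *: "0 < (\<Sum>j\<in>UNIV. a $ j * (axis i 1 $ j)\<^sup>2)" for i
    unfolding pos_def_def inner_diag_matrix by (simp add: axis_eq_0_iff)
  have "(\<Sum>j\<in>UNIV. a $ j * (axis i 1 $ j)\<^sup>2) = a $ i" for i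
    by (simp add: axis_def if_distrib[of "\<lambda>x. _ * x\<^sup>2"] cong: if_cong)
  with * show "\<forall>i. 0 < a $ i" by simp
next
  assume a: "\<forall>i. 0 < a $ i"
  have "0 < (\<Sum>i\<in>UNIV. a $ i * (x $ i)\<^sup>2)" if "x \<noteq> 0" for x
  proof -
    from that have "\<exists>k. x $ k \<noteq> 0" by (simp add: vec_eq_iff)
    then obtain k where "x $ k \<noteq> 0" ..
    moreover have "0 \<le> a $ i * (x $ i)\<^sup>2" for i
      using a[rule_format, of i] by simp
    ultimately show ?thesis
      using a by (intro sum_pos2[of _ k]) simp_all
  qed
  then show "pos_def (diag_matrix a)"
    by (simp add: pos_def_def inner_diag_matrix)
qed

lemma pos_def_invertible:
  assumes "pos_def A"
  shows "invertible A"
proof -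
  have "x = 0" if "A *v x = 0" for x
    using assms that unfolding pos_def_def by force
  then show ?thesis
    using matrix_left_invertible_ker invertible_left_inverse by metis
qed

lemma inner_congruence:
  "x \<bullet> ((T ** A ** transpose T) *v x) = (transpose T *v x) \<bullet> (A *v (transpose T *v x))"
  for T :: "real^'n^'m"
  by (metis matrix_vector_mul_assoc transpose_mult_inner transpose_transpose)

lemma transpose_congruence:
  "transpose A = A \<Longrightarrow> transpose (T ** A ** transpose T) = T ** A ** transpose T"
  for T :: "real^'n^'m"
  by (simp add: matrix_transpose_mul matrix_mul_assoc)

lemma pos_def_congruence:
  fixes T :: "real^'n^'n"
  assumes "pos_def A" "invertible T"
  shows "pos_def (T ** A ** transpose T)"
proof -
  have "transpose T *v x \<noteq> 0" if "x \<noteq> 0" for x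
    using that transpose_invertible[OF assms(2)] matrix_left_invertible_ker invertible_left_inverse
    by metis
  then show ?thesis
    using assms(1) unfolding pos_def_def inner_congruence by (simp add: transpose_congruence)
qed

section \<open>Spectral theorem and simultaneous diagonalization\<close>

text \<open>Induction on the dimension: a maximizer of the quadratic form on the unit sphere of
  \<open>S\<close> is an eigenvector, and by symmetry its orthogonal complement within
  \<open>S\<close> is again invariant. A general invariant \<open>S\<close> lets the induction pass
  to that complement.\<close>

lemma invariant_subspace_eigenbasis:
  fixes A :: "real^'n^'n"
  assumes "transpose A = A" "subspace S" "\<And>x. x \<in> S \<Longrightarrow> A *v x \<in> S"
  shows "\<exists>B. B \<subseteq> S \<and> pairwise orthogonal B \<and> (\<forall>x\<in>B. norm x = 1) \<and> finite B \<and> card B = dim S \<and>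
    (\<forall>x\<in>B. \<exists>c. A *v x = c *\<^sub>R x)"
  using assms(2,3)
proof (induction "dim S" arbitrary: S)
  case 0
  then show ?case by (intro exI[of _ "{}"]) auto
next
  case (Suc n)
  note S = \<open>subspace S\<close>
  let ?q = "\<lambda>x. x \<bullet> (A *v x)"
  have sym: "x \<bullet> (A *v y) = y \<bullet> (A *v x)" for x y
    by (metis assms(1) inner_commute transpose_mult_inner)
  obtain z where z: "z \<in> S" "z \<noteq> 0"
    using Suc.hyps(2) by (metis dim_eq_0 nat.simps(3) singleton_iff subsetI)
  have "z /\<^sub>R norm z \<in> sphere 0 1 \<inter> S"
    using z S by (simp add: subspace_scale)
  moreover have "compact (sphere 0 1 \<inter> S)"
    by (intro compact_Int_closed closed_subspace S compact_sphere)
  moreover have "continuous_on (sphere 0 1 \<inter> S) ?q"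
    by (intro continuous_intros matrix_vector_mult_linear_continuous_on)
  ultimately have "\<exists>v\<in>sphere 0 1 \<inter> S. \<forall>y\<in>sphere 0 1 \<inter> S. ?q y \<le> ?q v"
    by (intro continuous_attains_sup) blast+
  then obtain v where v: "v \<in> sphere 0 1 \<inter> S"
    and vmax: "\<And>y. y \<in> sphere 0 1 \<inter> S \<Longrightarrow> ?q y \<le> ?q v"
    by blast
  define c where "c = ?q v"
  have vv: "v \<bullet> v = 1" and vS: "v \<in> S" using v by (auto simp: norm_eq_1)
  \<comment> \<open>By homogeneity the bound on the unit sphere extends to all of
    \<open>S\<close>.\<close>
  have qle: "?q y \<le> c * (y \<bullet> y)" if "y \<in> S" for y
  proof (cases "y = 0")
    case False
    have "y /\<^sub>R norm y \<in> sphere 0 1 \<inter> S"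
      using that False S by (simp add: subspace_scale)
    from vmax[OF this] have "?q y / (norm y)\<^sup>2 \<le> c"
      by (simp add: c_def matrix_vector_mult_scaleR power2_eq_square divide_inverse ac_simps)
    then show ?thesis using False by (simp add: divide_simps power2_norm_eq_inner)
  qed simp
  \<comment> \<open>The residual of the eigenvalue equation; the aim is
    \<open>w = 0\<close>.\<close>
  define w where "w = A *v v - c *\<^sub>R v"
  have wS: "w \<in> S" unfolding w_def using S vS Suc.prems(2) by (simp add: subspace_diff subspace_scale)
  \<comment> \<open>Compare \<open>v\<close> with the competitor \<open>v + t *\<^sub>R w\<close>.
    The terms of order zero cancel because \<open>?q v = c\<close>, and the coefficient of
    \<open>2 * t\<close> is \<open>w \<bullet> (A *v v - c *\<^sub>R v)\<close>, which is
    \<open>w \<bullet> w\<close>.\<close>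
  have key: "2 * t * (w \<bullet> w) \<le> t\<^sup>2 * (c * (w \<bullet> w) - ?q w)" for t
  proof -
    have "v + t *\<^sub>R w \<in> S" using S vS wS by (simp add: subspace_add subspace_scale)
    from qle[OF this] have "?q v + 2 * t * (w \<bullet> (A *v v)) + t\<^sup>2 * ?q w
        \<le> c * (1 + 2 * t * (w \<bullet> v) + t\<^sup>2 * (w \<bullet> w))"
      using sym[of v w]
      by (simp add: matrix_vector_right_distrib matrix_vector_mult_scaleR inner_add_left inner_add_right
          vv inner_commute[of v w] power2_eq_square algebra_simps)
    then have "2 * t * (w \<bullet> (A *v v) - c * (w \<bullet> v)) \<le> t\<^sup>2 * (c * (w \<bullet> w) - ?q w)"
      by (simp add: c_def algebra_simps)
    also have "w \<bullet> (A *v v) - c * (w \<bullet> v) = w \<bullet> w"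
      by (subst (4) w_def) (simp add: inner_diff_right)
    finally show ?thesis .
  qed
  have "w \<bullet> w = 0"
  proof (rule ccontr)
    assume "w \<bullet> w \<noteq> 0"
    then have pos: "0 < w \<bullet> w" by (simp add: order_less_le)
    \<comment> \<open>For small positive \<open>t\<close> the linear term beats the quadratic one.
      With \<open>K\<close> a positive bound for the quadratic coefficient,
      \<open>t = (w \<bullet> w) / K\<close> turns \<open>key\<close> into
      \<open>2 * n\<^sup>2 / K \<le> n\<^sup>2 / K\<close> for
      \<open>n = w \<bullet> w > 0\<close>.\<close>
    define K where "K = \<bar>c * (w \<bullet> w) - ?q w\<bar> + 1"
    have K: "0 < K" "c * (w \<bullet> w) - ?q w \<le> K" by (auto simp: K_def)
    have "2 * ((w \<bullet> w) / K) * (w \<bullet> w) \<le> ((w \<bullet> w) / K)\<^sup>2 * K"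
      using key[of "(w \<bullet> w) / K"] mult_left_mono[OF K(2), of "((w \<bullet> w) / K)\<^sup>2"] by simp
    moreover have "\<not> 2 * (n / K) * n \<le> (n / K)\<^sup>2 * K" if "0 < n" for n
      using that K(1) by (simp add: power2_eq_square divide_simps)
    ultimately show False using pos by blast
  qed
  then have Av: "A *v v = c *\<^sub>R v" by (simp add: w_def)
  \<comment> \<open>Orthogonality to the whole span is the shape in which the dimension formula for
    complements applies; \<open>orth\<close> reduces it to \<open>v \<bullet> y = 0\<close>.\<close>
  define S' where "S' = {y \<in> S. \<forall>x\<in>span {v}. orthogonal x y}"
  have orth: "(\<forall>x\<in>span {v}. orthogonal x y) \<longleftrightarrow> v \<bullet> y = 0" for y
    by (auto simp: span_singleton orthogonal_def)
  have S'eq: "S' = {y \<in> S. v \<bullet> y = 0}" by (simp only: S'_def orth)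
  have S': "subspace S'"
    using S by (auto simp: S'eq subspace_def inner_add_right)
  have inv': "A *v x \<in> S'" if "x \<in> S'" for x
    using that Suc.prems(2) sym[of v x] Av by (simp add: S'eq inner_commute)
  have "dim S' + dim (span {v}) = dim S"
    unfolding S'_def by (intro dim_subspace_orthogonal_to_vectors span_minimal subspace_span S) (use vS in auto)
  moreover have "dim (span {v}) = 1"
    using vv by (subst dim_span) (auto simp: dim_insert)
  ultimately have "n = dim S'" using Suc.hyps(2) by simp
  from Suc.hyps(1)[OF this S' inv'] obtain B where B: "B \<subseteq> S'" "pairwise orthogonal B"
    "\<forall>x\<in>B. norm x = 1" "finite B" "card B = dim S'" "\<forall>x\<in>B. \<exists>c. A *v x = c *\<^sub>R x" by blast
  have "v \<notin> B" using B(1) vv S'eq by auto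
  show ?case
  proof (intro exI[of _ "insert v B"] conjI)
    show "insert v B \<subseteq> S" using B(1) vS S'eq by auto
    show "pairwise orthogonal (insert v B)"
      using B(1,2) S'eq by (auto simp: pairwise_insert orthogonal_def inner_commute)
    show "\<forall>x\<in>insert v B. norm x = 1" using B(3) v by auto
    show "card (insert v B) = dim S"
      using B(4,5) \<open>v \<notin> B\<close> \<open>n = dim S'\<close> Suc.hyps(2) by simp
    show "\<forall>x\<in>insert v B. \<exists>c. A *v x = c *\<^sub>R x" using B(6) Av by blast
  qed (use B in auto)
qed

text \<open>In the whole space there are \<open>CARD('n)\<close> orthonormal eigenvectors;
  enumerated by the index type they become the columns of \<open>Q\<close>.\<close>

lemma symmetric_matrix_diagonalization:
  fixes A :: "real^'n^'n"
  assumes "transpose A = A"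
  obtains Q :: "real^'n^'n" and l where "orthogonal_matrix Q" "A = Q ** diag_matrix l ** transpose Q"
proof -
  obtain B where B: "pairwise orthogonal B" "\<forall>x\<in>B. norm x = 1" "finite B" "card B = CARD('n)"
    and eig: "\<forall>x\<in>B. \<exists>c. A *v x = c *\<^sub>R x"
    using invariant_subspace_eigenbasis[OF assms subspace_UNIV] by (auto simp: dim_UNIV)
  obtain f where f: "bij_betw f (UNIV :: 'n set) B"
    using B(3,4) by (metis bij_betw_iff_card finite)
  have fB: "f j \<in> B" for j using f by (auto simp: bij_betw_def)
  obtain g where g: "\<And>x. x \<in> B \<Longrightarrow> A *v x = g x *\<^sub>R x" using eig by metis
  define Q :: "real^'n^'n" where "Q = (\<chi> i j. f j $ i)"
  define l :: "real^'n" where "l = (\<chi> j. g (f j))"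
  have ff: "f i \<bullet> f j = (if i = j then 1 else 0)" for i j
  proof (cases "i = j")
    case False
    then have "f i \<noteq> f j" using f by (auto simp: bij_betw_def inj_on_def)
    then show ?thesis using B(1) fB False by (auto simp: pairwise_def orthogonal_def)
  qed (use B(2) fB in \<open>auto simp: norm_eq_1\<close>)
  have "transpose Q ** Q = mat 1"
    using ff by (simp add: vec_eq_iff matrix_matrix_mult_def transpose_def Q_def mat_def inner_vec_def)
  then have Q: "orthogonal_matrix Q" by (simp add: orthogonal_matrix)
  have "(A ** Q) $ i $ j = (Q ** diag_matrix l) $ i $ j" for i j
  proof -
    have "(A ** Q) $ i $ j = (A *v f j) $ i"
      by (simp add: matrix_matrix_mult_def matrix_vector_mult_def Q_def)
    then show ?thesis
      using g[OF fB[of j]] by (simp add: diag_matrix_mult_right_nth Q_def l_def)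
  qed
  then have "A ** Q = Q ** diag_matrix l" by (simp add: vec_eq_iff)
  then have "A = Q ** diag_matrix l ** transpose Q"
    using Q by (metis matrix_mul_assoc matrix_mul_rid orthogonal_matrix_def)
  with Q that show thesis by blast
qed

text \<open>Factor \<open>B = Y ** transpose Y\<close> with \<open>Y\<close> invertible, pull
  \<open>A\<close> back to the symmetric \<open>A'\<close>, and diagonalize that by an orthogonal
  \<open>P\<close>, whose congruence fixes the identity; then \<open>X = Y ** P\<close>. The entries
  of \<open>l\<close> are the eigenvalues of the pencil \<open>(A, B)\<close>.\<close>

lemma pos_def_simultaneous_diagonalization:
  fixes A B :: "real^'n^'n"
  assumes "transpose A = A" "pos_def B"
  obtains X :: "real^'n^'n" and l where "invertible X" "A = X ** diag_matrix l ** transpose X" "B = X ** transpose X"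
proof -
  obtain Q b where Q: "orthogonal_matrix Q" and B: "B = Q ** diag_matrix b ** transpose Q"
    using assms(2) symmetric_matrix_diagonalization unfolding pos_def_def by blast
  have QQ: "transpose Q ** Q = mat 1" "Q ** transpose Q = mat 1"
    using Q by (auto simp: orthogonal_matrix_def)
  have "diag_matrix b = transpose Q ** B ** transpose (transpose Q)"
    by (metis B QQ(1) matrix_mul_assoc matrix_mul_lid matrix_mul_rid transpose_transpose)
  then have bpos: "0 < b $ i" for i
    using pos_def_congruence[OF assms(2), of "transpose Q"] QQ
    by (metis invertible_def pos_def_diag_matrix)
  define Y where "Y = Q ** diag_matrix (\<chi> i. sqrt (b $ i))"
  have Y: "invertible Y"
    unfolding Y_def by (intro invertible_mult invertible_diag_matrix)
      (use QQ bpos in \<open>auto simp: invertible_def less_imp_neq[symmetric]\<close>)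
  have "(diag_matrix (\<chi> i. sqrt (b $ i)) ** diag_matrix (\<chi> i. sqrt (b $ i))) = diag_matrix b"
    using bpos by (simp add: diag_matrix_mult less_imp_le)
  then have BY: "B = Y ** transpose Y"
    unfolding Y_def B by (metis matrix_mul_assoc matrix_transpose_mul transpose_diag_matrix)
  define A' where "A' = matrix_inv Y ** A ** transpose (matrix_inv Y)"
  obtain P l where P: "orthogonal_matrix P" and A': "A' = P ** diag_matrix l ** transpose P"
    using symmetric_matrix_diagonalization transpose_congruence[OF assms(1)] unfolding A'_def by blast
  have PP: "transpose P ** P = mat 1" "P ** transpose P = mat 1"
    using P by (auto simp: orthogonal_matrix_def)
  show thesis
  proof (rule that[of "Y ** P" l])
    show "invertible (Y ** P)"
      using Y PP by (intro invertible_mult) (auto simp: invertible_def)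
    have "A = (Y ** matrix_inv Y) ** A ** (transpose (matrix_inv Y) ** transpose Y)"
      by (simp add: matrix_inv_inverse[OF Y] flip: matrix_transpose_mul)
    also have "\<dots> = Y ** A' ** transpose Y" by (simp add: A'_def matrix_mul_assoc)
    finally show "A = Y ** P ** diag_matrix l ** transpose (Y ** P)"
      by (simp add: A' matrix_transpose_mul matrix_mul_assoc)
    show "B = Y ** P ** transpose (Y ** P)"
      by (metis BY PP(2) matrix_mul_assoc matrix_mul_rid matrix_transpose_mul)
  qed
qed

section \<open>Inverses, sums, kernels and ranks in diagonalized form\<close>

lemma transpose_matrix_inv_cancel:
  fixes W :: "real^'n^'n"
  assumes "invertible W"
  shows "transpose W ** transpose (matrix_inv W) = mat 1" "transpose (matrix_inv W) ** transpose W = mat 1"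
  by (simp_all add: matrix_inv_inverse[OF assms] flip: matrix_transpose_mul)

text \<open>With \<open>V = transpose (matrix_inv W)\<close> the right-hand side is a congruence by
  \<open>V\<close>: covariances are diagonal in the basis \<open>W\<close>, precisions in the dual
  basis \<open>V\<close>, and inversion acts entrywise.\<close>

lemma matrix_inv_diag_congruence:
  fixes W :: "real^'n^'n"
  assumes "invertible W" "\<And>i. f $ i \<noteq> 0"
  shows "matrix_inv (W ** diag_matrix f ** transpose W)
    = transpose (matrix_inv W) ** diag_matrix (\<chi> i. 1 / f $ i) ** matrix_inv W"
proof -
  have "invertible (W ** diag_matrix f)" "invertible (transpose W)"
    using assms by (auto intro: invertible_mult invertible_diag_matrix transpose_invertible)
  then show ?thesis
    using assms by (simp add: matrix_inv_mult invertible_diag_matrix matrix_inv_diag_matrix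
        matrix_inv_transpose matrix_mul_assoc)
qed

lemma diag_congruence_add:
  fixes W :: "real^'n^'m"
  shows "W ** diag_matrix f ** transpose W + W ** diag_matrix g ** transpose W
    = W ** diag_matrix (\<chi> i. f $ i + g $ i) ** transpose W"
  by (simp add: matrix_add_ldistrib matrix_add_rdistrib flip: diag_matrix_add)

text \<open>The kernel is the orthogonal complement of the row space, whose dimension is the
  rank.\<close>

lemma dim_kernel: "dim {x. A *v x = 0} + rank A = CARD('n)" for A :: "real^'n^'m"
proof -
  have "{x. A *v x = 0} = {x \<in> UNIV. \<forall>y\<in>span (rows A). orthogonal y x}"
  proof (intro set_eqI iffI)
    fix x assume x: "x \<in> {x. A *v x = 0}"
    have "orthogonal x y" if "y \<in> span (rows A)" for y
      using that
      by (rule orthogonal_to_span) (use x in \<open>auto simp: orthogonal_def rows_def row_def vec_eq_iff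
          matrix_vector_mult_def inner_vec_def vec_nth_inverse mult.commute\<close>)
    then show "x \<in> {x \<in> UNIV. \<forall>y\<in>span (rows A). orthogonal y x}" by (simp add: orthogonal_commute)
  next
    fix x assume x: "x \<in> {x \<in> UNIV. \<forall>y\<in>span (rows A). orthogonal y x}"
    have "row i A \<in> span (rows A)" for i by (intro span_base) (auto simp: rows_def)
    then have "row i A \<bullet> x = 0" for i using x by (auto simp: orthogonal_def)
    then show "x \<in> {x. A *v x = 0}"
      by (simp add: vec_eq_iff matrix_vector_mul_component row_def vec_lambda_eta)
  qed
  moreover have "dim {x \<in> UNIV. \<forall>y\<in>span (rows A). orthogonal y x} + dim (span (rows A)) = dim (UNIV :: (real^'n) set)"
    by (rule dim_subspace_orthogonal_to_vectors) auto
  ultimately show ?thesis by (simp add: row_rank_def)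
qed

lemma rank_diag_matrix_le:
  fixes v :: "real^'n"
  assumes "\<And>i. i \<notin> S \<Longrightarrow> v $ i = 0"
  shows "rank (diag_matrix v) \<le> card S"
proof -
  have "range ((*v) (diag_matrix v)) \<subseteq> {x. \<forall>i. i \<notin> S \<longrightarrow> x $ i = 0}"
    using assms by (auto simp: diag_matrix_vector_mult)
  then have "dim (range ((*v) (diag_matrix v))) \<le> dim {x :: real^'n. \<forall>i. i \<notin> S \<longrightarrow> x $ i = 0}"
    by (rule dim_subset)
  then show ?thesis
    by (simp add: rank_dim_range dim_substandard_cart[where 'a=real, unfolded dim_vec_eq])
qed

section \<open>The Foerstner distance\<close>

lemma pCons_sum: "[:sum f S:] = (\<Sum>k\<in>S. [:f k:])"
proof (induction S rule: infinite_finite_induct)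
  case (insert x S)
  then show ?case by (simp flip: insert.IH)
qed auto

lemma sum_pCons_linear: "(\<Sum>k\<in>S. [:f k, g k:]) = [:sum f S, sum g S:]"
  by (induction S rule: infinite_finite_induct) auto

text \<open>A congruence multiplies the pencil on both sides by constant matrices. Multiplicativity
  of \<open>det\<close> over polynomials then changes the pencil polynomial only by the nonzero
  constant \<open>(det X)\<^sup>2\<close>, so roots and multiplicities survive.\<close>

lemma pencil_poly_congruence:
  fixes E F X :: "real^'n^'n"
  assumes "invertible X"
  shows "proots (pencil_poly (X ** E ** transpose X) (X ** F ** transpose X)) = proots (pencil_poly E F)"
proof -
  \<comment> \<open>\<open>c\<close> embeds real matrices as matrices of constant polynomials;
    \<open>L\<close> is the pencil as a matrix of linear polynomials.\<close>
  define c :: "real^'n^'n \<Rightarrow> real poly^'n^'n" where "c = (\<lambda>A. \<chi> i j. [:A $ i $ j:])"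
  define L :: "real^'n^'n \<Rightarrow> real^'n^'n \<Rightarrow> real poly^'n^'n"
    where "L = (\<lambda>E F. \<chi> i j. [:E $ i $ j, - (F $ i $ j):])"
  have pencil: "pencil_poly E F = det (L E F)" for E F
    by (simp add: pencil_poly_def L_def)
  have left: "L (X ** E) (X ** F) = c X ** L E F" for X E F
    by (simp add: vec_eq_iff matrix_matrix_mult_def c_def L_def sum_pCons_linear sum_negf ac_simps)
  have right: "L (E ** X) (F ** X) = L E F ** c X" for X E F
    by (simp add: vec_eq_iff matrix_matrix_mult_def c_def L_def sum_pCons_linear sum_negf mult.commute)
  have prod_const: "(\<Prod>i\<in>S. [:f i:]) = [:prod f S:]" for f :: "'n \<Rightarrow> real" and S
    by (induction S rule: infinite_finite_induct) (auto simp: one_pCons)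
  have of_int_const: "(of_int k :: real poly) = [:of_int k:]" for k
    by (simp add: of_int_poly)
  have det_c: "det (c A) = [:det A:]" for A
    by (simp add: det_def c_def prod_const of_int_const pCons_sum mult.commute)
  have "pencil_poly (X ** E ** transpose X) (X ** F ** transpose X)
      = [:det X:] * pencil_poly E F * [:det X:]"
    by (simp add: pencil left right det_mul det_c)
  moreover have "det X \<noteq> 0" using assms by (simp add: invertible_det_nz)
  ultimately show ?thesis by simp
qed

lemma foerstner_dist_sq_congruence:
  fixes E F X :: "real^'n^'n"
  assumes "invertible X"
  shows "foerstner_dist_sq (X ** E ** transpose X) (X ** F ** transpose X) = foerstner_dist_sq E F"
  by (simp add: foerstner_dist_sq_def pencil_poly_congruence[OF assms])

text \<open>The determinant splits into the factors \<open>[:a $ i, - (b $ i):]\<close>, each with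
  the single root \<open>a $ i / b $ i\<close>.\<close>

lemma foerstner_dist_sq_diag:
  fixes a b :: "real^'n"
  assumes "\<And>i. b $ i \<noteq> 0"
  shows "foerstner_dist_sq (diag_matrix a) (diag_matrix b) = (\<Sum>i\<in>UNIV. (ln (a $ i / b $ i))\<^sup>2)"
proof -
  have lin: "proots [:a $ i, - (b $ i):] = {#a $ i / b $ i#}" for i
  proof -
    have "proots [:a $ i, - (b $ i):] = proots (smult (- (b $ i)) [:- (a $ i / b $ i), 1:])"
      using assms[of i] by simp
    also have "\<dots> = proots [:- (a $ i / b $ i), 1:]"
      by (rule proots_smult) (use assms in simp)
    finally show ?thesis by (simp only: proots_linear_factor minus_minus)
  qed
  have "pencil_poly (diag_matrix a) (diag_matrix b) = (\<Prod>i\<in>UNIV. [:a $ i, - (b $ i):])"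
    unfolding pencil_poly_def by (subst det_diagonal) auto
  then have "proots (pencil_poly (diag_matrix a) (diag_matrix b)) = (\<Sum>i\<in>UNIV. {#a $ i / b $ i#})"
    using assms by (simp add: proots_prod lin)
  moreover have "(\<Sum>x\<in>#(\<Sum>i\<in>S. {#f i#}). g x) = (\<Sum>i\<in>S. g (f i))"
    for S :: "'n set" and f :: "'n \<Rightarrow> real" and g :: "real \<Rightarrow> real"
    by (induction S rule: infinite_finite_induct) auto
  ultimately show ?thesis by (simp add: foerstner_dist_sq_def)
qed

section \<open>Lower bound for the Foerstner distance by counting eigenvalues\<close>

text \<open>Greedy matching: the largest \<open>g j\<close> is paired with some \<open>f i\<close>
  at least as large, and both are removed. Only counts above levels are compared, so no explicit
  sorting of either family is required. Nonnegativity of \<open>f\<close> disposes of unmatched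
  indices.\<close>

lemma sum_le_sum_if_card_le:
  fixes f :: "'a \<Rightarrow> real" and g :: "'b \<Rightarrow> real"
  assumes "finite J" "finite I" "\<And>i. i \<in> I \<Longrightarrow> 0 \<le> f i"
    and "\<And>j. j \<in> J \<Longrightarrow> card {k\<in>J. g j \<le> g k} \<le> card {i\<in>I. g j \<le> f i}"
  shows "sum g J \<le> sum f I"
  using assms
proof (induction "card J" arbitrary: I J)
  case 0
  then show ?case by (simp add: sum_nonneg)
next
  case (Suc n)
  then have "J \<noteq> {}" by auto
  then obtain j where j: "j \<in> J" "\<And>k. k \<in> J \<Longrightarrow> g k \<le> g j"
  proof -
    have "Max (g ` J) \<in> g ` J" using Suc.prems(1) \<open>J \<noteq> {}\<close> by simp
    then obtain j where "j \<in> J" "g j = Max (g ` J)" by auto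
    then show thesis using that[OF \<open>j \<in> J\<close>] Suc.prems(1) by simp
  qed
  have "{k\<in>J. g j \<le> g k} \<noteq> {}" using j(1) by blast
  then have "0 < card {k\<in>J. g j \<le> g k}" using Suc.prems(1) by (simp add: card_gt_0_iff)
  then have "0 < card {i\<in>I. g j \<le> f i}" using Suc.prems(4)[OF j(1)] by linarith
  then obtain i where i: "i \<in> I" "g j \<le> f i" by (auto simp: card_gt_0_iff)
  have "sum g (J - {j}) \<le> sum f (I - {i})"
  proof (rule Suc.hyps(1))
    show "n = card (J - {j})" using Suc.hyps(2) Suc.prems(1) j(1) by simp
    \<comment> \<open>The level satisfies \<open>g k \<le> g j \<le> f i\<close>, so removing
      \<open>j\<close> and \<open>i\<close> lowers each count by exactly one.\<close>
    fix k assume k: "k \<in> J - {j}"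
    then have gk: "g k \<le> g j" using j by blast
    have "{l\<in>J - {j}. g k \<le> g l} = {l\<in>J. g k \<le> g l} - {j}"
      "{l\<in>I - {i}. g k \<le> f l} = {l\<in>I. g k \<le> f l} - {i}" by auto
    then show "card {l\<in>J - {j}. g k \<le> g l} \<le> card {l\<in>I - {i}. g k \<le> f l}"
      using Suc.prems(1,2) Suc.prems(4)[of k] k gk i j(1) by (auto intro: diff_le_mono)
  qed (use Suc.prems in auto)
  moreover have "sum g J = g j + sum g (J - {j})" "sum f I = f i + sum f (I - {i})"
    using i(1) j(1) Suc.prems(1,2) by (simp_all add: sum.remove)
  ultimately show ?case using i(2) by simp
qed

text \<open>One half of the Courant-Fischer principle. In the coordinates
  \<open>y = transpose X *v x\<close> the form with coefficients \<open>l $ i - t\<close> is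
  nonpositive on the image of \<open>N\<close> and positive on nonzero vectors supported where
  \<open>t < l $ i\<close>. The two subspaces meet only in 0, so their dimensions add up to at most
  \<open>CARD('n)\<close>.\<close>

lemma dim_le_card_pencil_eigenvalues:
  fixes X :: "real^'n^'n"
  assumes X: "invertible X" and N: "subspace N"
    and le: "\<And>x. x \<in> N \<Longrightarrow> x \<bullet> ((X ** diag_matrix l ** transpose X) *v x) \<le> t * (x \<bullet> ((X ** transpose X) *v x))"
  shows "dim N \<le> card {i. l $ i \<le> t}"
proof -
  define N' where "N' = (*v) (transpose X) ` N"
  define P where "P = {y :: real^'n. \<forall>i. i \<notin> {i. t < l $ i} \<longrightarrow> y $ i = 0}"
  have "inj ((*v) (transpose X))"
    using transpose_invertible[OF X] by (simp add: inj_matrix_vector_mult)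
  then have dimN': "dim N' = dim N"
    unfolding N'_def by (metis dim_image_eq inj_on_subset matrix_vector_mul_linear subset_UNIV)
  have subN': "subspace N'"
    unfolding N'_def by (intro linear_subspace_image matrix_vector_mul_linear N)
  have subP: "subspace P" by (auto simp: P_def subspace_def)
  have dimP: "dim P = card {i. t < l $ i}"
    unfolding P_def by (rule dim_substandard_cart[where 'a=real, unfolded dim_vec_eq])
  have "y = 0" if "y \<in> N' \<inter> P" for y
  proof -
    from that have "y \<in> N'" by blast
    then obtain x where x: "x \<in> N" "y = transpose X *v x" unfolding N'_def by blast
    have "(\<Sum>i\<in>UNIV. l $ i * (y $ i)\<^sup>2) \<le> t * (y \<bullet> y)"
      using le[OF x(1)] inner_congruence[of x X "diag_matrix l"] inner_congruence[of x X "mat 1"]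
      by (simp add: x(2) inner_diag_matrix del: transpose_matrix_vector)
    then have "(\<Sum>i\<in>UNIV. (l $ i - t) * (y $ i)\<^sup>2) \<le> 0"
      by (simp add: inner_vec_def power2_eq_square sum_distrib_left algebra_simps sum_subtractf)
    moreover have nonneg: "0 \<le> (l $ i - t) * (y $ i)\<^sup>2" for i
      using that by (cases "t < l $ i") (auto simp: P_def)
    ultimately have "(\<Sum>i\<in>UNIV. (l $ i - t) * (y $ i)\<^sup>2) = 0"
      by (simp add: sum_nonneg order_antisym)
    then have zero: "(l $ i - t) * (y $ i)\<^sup>2 = 0" for i
      using nonneg by (subst (asm) sum_nonneg_eq_0_iff) auto
    have "y $ i = 0" for i
      using that zero[of i] by (cases "t < l $ i") (auto simp: P_def)
    then show ?thesis by (simp add: vec_eq_iff)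
  qed
  then have "N' \<inter> P \<subseteq> {0}" by blast
  then have "dim (N' \<inter> P) = 0" by (simp add: dim_eq_0)
  moreover have "dim {x + y | x y. x \<in> N' \<and> y \<in> P} \<le> CARD('n)"
    by (rule dim_subset_UNIV_cart)
  ultimately have "dim N + card {i. t < l $ i} \<le> CARD('n)"
    using dim_sums_Int[OF subN' subP] dimN' dimP by linarith
  moreover have "card {i. l $ i \<le> t} + card {i. t < l $ i} = CARD('n)"
    by (subst card_Un_disjoint[symmetric]) (auto intro: arg_cong[of _ _ card])
  ultimately show ?thesis by linarith
qed

text \<open>Test space: vectors supported on \<open>{i. a $ i \<le> t}\<close> and killed by
  \<open>transpose K\<close>. There the first form is at most \<open>t * (x \<bullet> x)\<close> and
  the second equals \<open>x \<bullet> x\<close>; the kernel condition costs at most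
  \<open>rank K\<close> dimensions.\<close>

lemma card_le_card_pencil_eigenvalues:
  fixes K X :: "real^'n^'n"
  assumes X: "invertible X" and A: "diag_matrix a = X ** diag_matrix l ** transpose X"
    and B: "mat 1 - K ** transpose K = X ** transpose X"
  shows "card {i. a $ i \<le> t} \<le> card {i. l $ i \<le> t} + rank K"
proof -
  define S where "S = {x :: real^'n. \<forall>i. i \<notin> {i. a $ i \<le> t} \<longrightarrow> x $ i = 0}"
  define T where "T = {x. transpose K *v x = 0}"
  have subS: "subspace S" by (auto simp: S_def subspace_def)
  have subT: "subspace T"
    unfolding T_def by (auto simp: subspace_def matrix_vector_right_distrib
        matrix_vector_mult_scaleR simp del: transpose_matrix_vector)
  have "dim S = card {i. a $ i \<le> t}"
    unfolding S_def by (rule dim_substandard_cart[where 'a=real, unfolded dim_vec_eq])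
  moreover have "dim T + rank K = CARD('n)"
    unfolding T_def using dim_kernel[of "transpose K"] by (simp add: rank_transpose)
  moreover have "dim {x + y | x y. x \<in> S \<and> y \<in> T} \<le> CARD('n)"
    by (rule dim_subset_UNIV_cart)
  ultimately have "card {i. a $ i \<le> t} \<le> dim (S \<inter> T) + rank K"
    using dim_sums_Int[OF subS subT] by linarith
  moreover have "dim (S \<inter> T) \<le> card {i. l $ i \<le> t}"
  proof (rule dim_le_card_pencil_eigenvalues[OF X subspace_inter[OF subS subT]])
    fix x assume x: "x \<in> S \<inter> T"
    have "a $ i * (x $ i)\<^sup>2 \<le> t * (x $ i)\<^sup>2" for i
      using x by (cases "a $ i \<le> t") (auto simp: S_def mult_right_mono)
    then have "x \<bullet> (diag_matrix a *v x) \<le> t * (x \<bullet> x)"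
      unfolding inner_diag_matrix
      by (simp add: inner_vec_def sum_distrib_left sum_mono flip: power2_eq_square)
    moreover have "x \<bullet> ((mat 1 - K ** transpose K) *v x) = x \<bullet> x"
      using x by (simp add: T_def matrix_vector_mult_diff_rdistrib flip: matrix_vector_mul_assoc
          del: transpose_matrix_vector)
    ultimately show "x \<bullet> ((X ** diag_matrix l ** transpose X) *v x) \<le> t * (x \<bullet> ((X ** transpose X) *v x))"
      using A B by simp
  qed
  ultimately show ?thesis by linarith
qed

text \<open>\<open>S\<close> holds the indices of the smallest \<open>a $ i\<close>, whose
  logarithms are farthest from 0. Counting the pencil eigenvalues below each remaining
  \<open>a $ j\<close> feeds \<open>sum_le_sum_if_card_le\<close>.\<close>

lemma foerstner_dist_sq_lower_bound:
  fixes K :: "real^'n^'n"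
  assumes a: "\<And>i. 0 < a $ i" "\<And>i. a $ i < 1"
    and S: "card S = r" "\<And>i j. i \<in> S \<Longrightarrow> j \<notin> S \<Longrightarrow> a $ i \<le> a $ j"
    and K: "pos_def (mat 1 - K ** transpose K)" "rank K \<le> r"
  shows "(\<Sum>j\<in>-S. (ln (a $ j))\<^sup>2) \<le> foerstner_dist_sq (diag_matrix a) (mat 1 - K ** transpose K)"
proof -
  obtain X :: "real^'n^'n" and l where X: "invertible X"
    and A: "diag_matrix a = X ** diag_matrix l ** transpose X"
    and B: "mat 1 - K ** transpose K = X ** transpose X"
    using pos_def_simultaneous_diagonalization[OF transpose_diag_matrix K(1)] by metis
  \<comment> \<open>The pencil eigenvalues are positive because \<open>diag_matrix l\<close> is
    congruent to \<open>diag_matrix a\<close>.\<close>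
  have "diag_matrix l = matrix_inv X ** diag_matrix a ** transpose (matrix_inv X)"
  proof -
    have "matrix_inv X ** diag_matrix a ** transpose (matrix_inv X)
        = (matrix_inv X ** X) ** diag_matrix l ** (transpose X ** transpose (matrix_inv X))"
      by (simp add: A matrix_mul_assoc)
    then show ?thesis
      by (simp add: matrix_inv_inverse[OF X] flip: matrix_transpose_mul)
  qed
  then have l: "0 < l $ i" for i
    using pos_def_congruence[of "diag_matrix a", OF _ invertible_matrix_inv[OF X]] a(1)
    by (metis pos_def_diag_matrix)
  have "foerstner_dist_sq (diag_matrix a) (mat 1 - K ** transpose K)
      = foerstner_dist_sq (diag_matrix l) (diag_matrix (\<chi> i. 1))"
    unfolding A B using foerstner_dist_sq_congruence[OF X, of "diag_matrix l" "mat 1"]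
    by (simp add: diag_matrix_1)
  also have "\<dots> = (\<Sum>i\<in>UNIV. (ln (l $ i))\<^sup>2)"
    by (subst foerstner_dist_sq_diag) auto
  also have "\<dots> \<ge> (\<Sum>j\<in>-S. (ln (a $ j))\<^sup>2)"
  proof (rule sum_le_sum_if_card_le)
    fix j assume j: "j \<in> - S"
    \<comment> \<open>The squared logarithm decreases between 0 and 1, so large squared logarithms
      correspond to small values. This is where \<open>a $ i < 1\<close> enters.\<close>
    have ln_mono: "(ln y)\<^sup>2 \<le> (ln x)\<^sup>2" if "0 < x" "x \<le> y" "y < 1" for x y :: real
    proof -
      have "ln x \<le> ln y" "ln y < 0" using that by auto
      then show ?thesis by (simp add: abs_le_square_iff[symmetric])
    qed
    have "a $ k \<le> a $ j" if "(ln (a $ j))\<^sup>2 \<le> (ln (a $ k))\<^sup>2" for k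
    proof -
      have "ln (a $ k) < 0" "ln (a $ j) < 0" using a by auto
      then have "ln (a $ k) \<le> ln (a $ j)" using that by (simp add: abs_le_square_iff[symmetric])
      then show ?thesis using a by simp
    qed
    then have "{k\<in>-S. (ln (a $ j))\<^sup>2 \<le> (ln (a $ k))\<^sup>2} \<subseteq> {k. a $ k \<le> a $ j} - S" by auto
    then have "card {k\<in>-S. (ln (a $ j))\<^sup>2 \<le> (ln (a $ k))\<^sup>2} \<le> card ({k. a $ k \<le> a $ j} - S)"
      by (intro card_mono) auto
    \<comment> \<open>For \<open>j\<close> outside \<open>S\<close> the set contains all of
      \<open>S\<close>, so the count drops by exactly \<open>r\<close>; the bound
      \<open>rank K \<le> r\<close> makes up for this in the next step.\<close>
    also have "\<dots> = card {k. a $ k \<le> a $ j} - r"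
      using S j by (subst card_Diff_subset) auto
    also have "\<dots> \<le> card {i. l $ i \<le> a $ j}"
      using card_le_card_pencil_eigenvalues[OF X A B, of "a $ j"] K(2) by linarith
    also have "\<dots> \<le> card {i\<in>UNIV. (ln (a $ j))\<^sup>2 \<le> (ln (l $ i))\<^sup>2}"
      using l a(2) ln_mono by (intro card_mono) auto
    finally show "card {k\<in>-S. (ln (a $ j))\<^sup>2 \<le> (ln (a $ k))\<^sup>2}
        \<le> card {i\<in>UNIV. (ln (a $ j))\<^sup>2 \<le> (ln (l $ i))\<^sup>2}" .
  qed auto
  finally show ?thesis .
qed

text \<open>Whitening by \<open>T\<close> turns the prior into the identity and the update factor
  \<open>K\<close> into \<open>J\<close>, whose rank is no larger.\<close>

lemma foerstner_dist_sq_lower_bound_cov_class: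
  fixes T :: "real^'n^'n"
  assumes T: "invertible T" and \<Gamma>: "\<Gamma> \<in> cov_class (card S) (T ** transpose T)"
    and a: "\<And>i. 0 < a $ i" "\<And>i. a $ i < 1" "\<And>i j. i \<in> S \<Longrightarrow> j \<notin> S \<Longrightarrow> a $ i \<le> a $ j"
  shows "(\<Sum>j\<in>-S. (ln (a $ j))\<^sup>2) \<le> foerstner_dist_sq (T ** diag_matrix a ** transpose T) \<Gamma>"
proof -
  obtain K :: "real^'n^'n" where K: "\<Gamma> = T ** transpose T - K ** transpose K" "rank K \<le> card S" "pos_def \<Gamma>"
    using \<Gamma> unfolding cov_class_def by blast
  define J where "J = matrix_inv T ** K"
  have TJ: "T ** J = K"
    by (simp add: J_def matrix_mul_assoc matrix_inv_inverse[OF T])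
  have "T ** (J ** transpose J) ** transpose T = K ** transpose K"
    unfolding TJ[symmetric] by (simp add: matrix_transpose_mul matrix_mul_assoc)
  then have \<Gamma>_eq: "\<Gamma> = T ** (mat 1 - J ** transpose J) ** transpose T"
    by (simp add: matrix_diff_ldistrib matrix_diff_rdistrib K(1))
  have "mat 1 - J ** transpose J = matrix_inv T ** \<Gamma> ** transpose (matrix_inv T)"
  proof -
    have "matrix_inv T ** \<Gamma> ** transpose (matrix_inv T)
        = (matrix_inv T ** T) ** (mat 1 - J ** transpose J) ** (transpose T ** transpose (matrix_inv T))"
      unfolding \<Gamma>_eq by (simp only: matrix_mul_assoc)
    then show ?thesis
      by (simp add: matrix_inv_inverse[OF T] flip: matrix_transpose_mul)
  qed
  then have "pos_def (mat 1 - J ** transpose J)"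
    using pos_def_congruence[OF K(3) invertible_matrix_inv[OF T]] by simp
  moreover have "rank J \<le> card S"
    using rank_mul_le_right[of "matrix_inv T" K] K(2) by (simp add: J_def)
  ultimately show ?thesis
    using foerstner_dist_sq_lower_bound[OF a(1,2) refl a(3)]
    by (simp add: \<Gamma>_eq foerstner_dist_sq_congruence[OF T])
qed

section \<open>Mean square error of low-rank estimators\<close>

text \<open>Exchange argument with threshold \<open>t\<close>, the largest value of \<open>d\<close>
  outside \<open>S\<close>. The weight missing outside \<open>S\<close>, the sum of
  \<open>1 - c i\<close>, is at most the weight present on \<open>S\<close>; a missing unit is worth
  at most \<open>t\<close>, a present one at least \<open>t\<close>.\<close>

lemma sum_le_weighted_sum:
  fixes c d :: "'n::finite \<Rightarrow> real"
  assumes c: "\<And>i. 0 \<le> c i" "\<And>i. c i \<le> 1" "real CARD('n) \<le> sum c UNIV + real (card S)"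
    and d: "\<And>i. 0 \<le> d i" "\<And>i j. i \<in> S \<Longrightarrow> j \<notin> S \<Longrightarrow> d j \<le> d i"
  shows "sum d (- S) \<le> (\<Sum>i\<in>UNIV. c i * d i)"
proof (cases "- S = {}")
  case True
  then show ?thesis using c d by (simp add: sum_nonneg)
next
  case False
  define t where "t = Max (d ` (- S))"
  have t: "d j \<le> t" if "j \<notin> S" for j using that by (simp add: t_def)
  have "t \<in> d ` (- S)" unfolding t_def using False by (intro Max_in) auto
  then have t0: "0 \<le> t" and tS: "\<And>i. i \<in> S \<Longrightarrow> t \<le> d i" using d by auto
  have split: "(\<Sum>i\<in>UNIV. f i) = (\<Sum>i\<in>S. f i) + (\<Sum>i\<in>-S. f i)" for f :: "'n \<Rightarrow> real"
    by (subst sum.union_disjoint[symmetric]) (auto simp: Compl_partition)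
  have "card S + card (- S) = CARD('n)"
    by (subst card_Un_disjoint[symmetric]) (auto simp: Compl_partition)
  then have "(\<Sum>i\<in>-S. 1 - c i) \<le> sum c S"
    using c(3) split[of c] by (simp add: sum_subtractf)
  then have "t * (\<Sum>i\<in>-S. 1 - c i) \<le> t * sum c S" using t0 by (rule mult_left_mono)
  moreover have "t * sum c S \<le> (\<Sum>i\<in>S. c i * d i)"
    unfolding sum_distrib_left using tS c(1) by (intro sum_mono) (simp add: mult.commute[of t] mult_left_mono)
  moreover have "(\<Sum>i\<in>-S. (1 - c i) * d i) \<le> t * (\<Sum>i\<in>-S. 1 - c i)"
    unfolding sum_distrib_left using t c(2) by (intro sum_mono) (simp add: mult.commute[of t] mult_left_mono)
  moreover have "sum d (- S) = (\<Sum>i\<in>-S. c i * d i) + (\<Sum>i\<in>-S. (1 - c i) * d i)"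
    by (simp add: algebra_simps flip: sum.distrib)
  ultimately show ?thesis using split[of "\<lambda>i. c i * d i"] by linarith
qed

text \<open>\<open>p\<close> is the orthogonal projection of \<open>x\<close> to the span of
  \<open>U\<close>. Both \<open>p \<bullet> p\<close> and \<open>p \<bullet> x\<close> equal the
  sum, and \<open>x - p\<close> has nonnegative squared length.\<close>

lemma bessel_inequality:
  fixes U :: "'a::real_inner set"
  assumes "finite U" "pairwise orthogonal U" "\<And>u. u \<in> U \<Longrightarrow> norm u = 1"
  shows "(\<Sum>u\<in>U. (u \<bullet> x)\<^sup>2) \<le> x \<bullet> x"
proof -
  define p where "p = (\<Sum>u\<in>U. (u \<bullet> x) *\<^sub>R u)"
  have up: "u \<bullet> p = u \<bullet> x" if u: "u \<in> U" for u
  proof -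
    have "u \<bullet> p = (\<Sum>v\<in>U. if v = u then u \<bullet> x else 0)"
      unfolding p_def inner_sum_right
      using assms(2,3) u by (intro sum.cong) (auto simp: pairwise_def orthogonal_def norm_eq_1)
    then show ?thesis using u assms(1) by simp
  qed
  have px: "p \<bullet> x = (\<Sum>u\<in>U. (u \<bullet> x)\<^sup>2)"
    by (simp add: p_def inner_sum_left power2_eq_square)
  have "p \<bullet> p = (\<Sum>u\<in>U. (u \<bullet> x) * (u \<bullet> p))"
    by (subst p_def) (simp add: inner_sum_left)
  then have "p \<bullet> p = (\<Sum>u\<in>U. (u \<bullet> x)\<^sup>2)" by (simp add: up power2_eq_square)
  moreover have "0 \<le> (x - p) \<bullet> (x - p)" by simp
  ultimately show ?thesis
    using px by (simp add: inner_diff_left inner_diff_right inner_commute)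
qed

section \<open>Moments of the linear Gaussian model\<close>

text \<open>The case split mirrors the definition: a degenerate direction gives an almost surely
  zero variable, any other one a normal density.\<close>

lemma gaussian_vector_moments:
  assumes "prob_space M" "gaussian_vector M X C"
  shows "integrable M (\<lambda>\<omega>. t \<bullet> X \<omega>)" "(\<integral>\<omega>. t \<bullet> X \<omega> \<partial>M) = 0"
    and "integrable M (\<lambda>\<omega>. (t \<bullet> X \<omega>)\<^sup>2)" "(\<integral>\<omega>. (t \<bullet> X \<omega>)\<^sup>2 \<partial>M) = t \<bullet> (C *v t)"
proof -
  have [measurable]: "X \<in> borel_measurable M"
    using assms(2) unfolding gaussian_vector_def by blast
  have meas: "(\<lambda>\<omega>. t \<bullet> X \<omega>) \<in> borel_measurable M"
    by measurable
  have "integrable M (\<lambda>\<omega>. t \<bullet> X \<omega>) \<and> (\<integral>\<omega>. t \<bullet> X \<omega> \<partial>M) = 0 \<and>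
    integrable M (\<lambda>\<omega>. (t \<bullet> X \<omega>)\<^sup>2) \<and> (\<integral>\<omega>. (t \<bullet> X \<omega>)\<^sup>2 \<partial>M) = t \<bullet> (C *v t)"
  proof (cases "t \<bullet> (C *v t) = 0")
    case True
    then have "AE \<omega> in M. t \<bullet> X \<omega> = 0" using assms(2) unfolding gaussian_vector_def by metis
    then have AE: "AE \<omega> in M. t \<bullet> X \<omega> = 0" "AE \<omega> in M. (t \<bullet> X \<omega>)\<^sup>2 = 0" by auto
    have "integrable M (\<lambda>\<omega>. t \<bullet> X \<omega>)" "integrable M (\<lambda>\<omega>. (t \<bullet> X \<omega>)\<^sup>2)"
      using AE meas by (subst integrable_cong_AE[where g="\<lambda>_. 0"]; simp)+
    moreover have "(\<integral>\<omega>. t \<bullet> X \<omega> \<partial>M) = 0" "(\<integral>\<omega>. (t \<bullet> X \<omega>)\<^sup>2 \<partial>M) = 0"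
      using AE by (simp_all add: integral_eq_zero_AE)
    ultimately show ?thesis using True by simp
  next
    case False
    define s where "s = sqrt (t \<bullet> (C *v t))"
    have "0 \<le> t \<bullet> (C *v t)"
      using assms(2) unfolding gaussian_vector_def pos_semidef_def by blast
    then have s: "0 < s" "s\<^sup>2 = t \<bullet> (C *v t)" using False by (simp_all add: s_def)
    have D: "distributed M lborel (\<lambda>\<omega>. t \<bullet> X \<omega>) (normal_density 0 s)"
      using assms(2) False unfolding gaussian_vector_def s_def by metis
    \<comment> \<open>Instance 1 of the even moment formula is the variance; instance 0 of the odd
      one, used next, is the mean.\<close>
    have "has_bochner_integral lborel (\<lambda>x. normal_density 0 s x * x\<^sup>2) (s\<^sup>2)"
      using normal_moment_even[OF s(1), of 0 1] by (simp add: fact_numeral)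
    moreover have "has_bochner_integral lborel (\<lambda>x. normal_density 0 s x * x) 0"
      using normal_moment_odd[OF s(1), of 0 0] by simp
    ultimately show ?thesis
      using distributed_integrable[OF D, of "\<lambda>x. x"] distributed_integral[OF D, of "\<lambda>x. x"]
        distributed_integrable[OF D, of "\<lambda>x. x\<^sup>2"] distributed_integral[OF D, of "\<lambda>x. x\<^sup>2"]
      by (auto simp: has_bochner_integral_iff s)
  qed
  then show "integrable M (\<lambda>\<omega>. t \<bullet> X \<omega>)" "(\<integral>\<omega>. t \<bullet> X \<omega> \<partial>M) = 0"
    "integrable M (\<lambda>\<omega>. (t \<bullet> X \<omega>)\<^sup>2)" "(\<integral>\<omega>. (t \<bullet> X \<omega>)\<^sup>2 \<partial>M) = t \<bullet> (C *v t)"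
    by blast+
qed

text \<open>A linear functional generates a smaller sigma-algebra than the vector itself. Passing to
  functionals makes both variables real, so \<open>indep_var\<close> and its product rule for
  integrals apply.\<close>

lemma indep_vectors_imp_indep_var_inner:
  assumes "prob_space M" "indep_vectors M X Y"
  shows "prob_space.indep_var M borel (\<lambda>\<omega>. a \<bullet> X \<omega>) borel (\<lambda>\<omega>. b \<bullet> Y \<omega>)"
proof -
  interpret prob_space M by fact
  have XY [measurable]: "X \<in> borel_measurable M" "Y \<in> borel_measurable M"
    and indep: "indep_set (sets (vimage_algebra (space M) X borel)) (sets (vimage_algebra (space M) Y borel))"
    using assms(2) by (auto simp: indep_vectors_def)
  have sub: "sigma_sets (space M) {(\<lambda>\<omega>. c \<bullet> Z \<omega>) -` A \<inter> space M | A. A \<in> sets borel}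
      \<subseteq> sets (vimage_algebra (space M) Z borel)" for Z :: "'a \<Rightarrow> real^'n" and c
  proof -
    have "(\<lambda>\<omega>. c \<bullet> Z \<omega>) -` A \<inter> space M \<in> sets (vimage_algebra (space M) Z borel)"
      if "A \<in> sets borel" for A
    proof -
      have "(\<lambda>x. c \<bullet> x) -` A \<in> sets borel"
        using measurable_sets[of "\<lambda>x. c \<bullet> x" borel borel A] that by simp
      from in_vimage_algebra[OF this, of Z "space M"] show ?thesis
        by (simp add: vimage_def)
    qed
    then have "{(\<lambda>\<omega>. c \<bullet> Z \<omega>) -` A \<inter> space M | A. A \<in> sets borel}
      \<subseteq> sets (vimage_algebra (space M) Z borel)" by blast
    from sets.sigma_sets_subset[OF this] show ?thesis by simp
  qed
  show ?thesis
    unfolding indep_var_eq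
  proof (intro conjI)
    show "indep_set (sigma_sets (space M) {(\<lambda>\<omega>. a \<bullet> X \<omega>) -` A \<inter> space M | A. A \<in> sets borel})
       (sigma_sets (space M) {(\<lambda>\<omega>. b \<bullet> Y \<omega>) -` A \<inter> space M | A. A \<in> sets borel})"
      using indep sub[of a X] sub[of b Y] unfolding indep_sets2_eq by blast
  qed measurable
qed

text \<open>Move \<open>B\<close> to the other side of the inner product and expand the square; the
  mixed term integrates to 0, because independence factors it and the means vanish.\<close>

lemma linear_model_second_moment:
  fixes B :: "real^'n^'m"
  assumes "prob_space M" "gaussian_vector M X C" "gaussian_vector M Y D" "indep_vectors M X Y"
  shows "integrable M (\<lambda>\<omega>. (t \<bullet> (B *v X \<omega> + Y \<omega>))\<^sup>2)"
    and "(\<integral>\<omega>. (t \<bullet> (B *v X \<omega> + Y \<omega>))\<^sup>2 \<partial>M) = t \<bullet> ((B ** C ** transpose B + D) *v t)"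
proof -
  interpret prob_space M by fact
  define a where "a = transpose B *v t"
  have eq: "(\<lambda>\<omega>. (t \<bullet> (B *v X \<omega> + Y \<omega>))\<^sup>2)
      = (\<lambda>\<omega>. (a \<bullet> X \<omega>)\<^sup>2 + (t \<bullet> Y \<omega>)\<^sup>2 + 2 * ((a \<bullet> X \<omega>) * (t \<bullet> Y \<omega>)))"
    unfolding a_def using transpose_mult_inner[of "transpose B" t]
    by (simp add: inner_add_right power2_sum algebra_simps del: transpose_matrix_vector)
  note mX = gaussian_vector_moments[OF assms(1,2), of a]
  note mY = gaussian_vector_moments[OF assms(1,3), of t]
  note ind = indep_vectors_imp_indep_var_inner[OF assms(1,4), of a t]
  have i: "integrable M (\<lambda>\<omega>. (a \<bullet> X \<omega>) * (t \<bullet> Y \<omega>))"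
    by (rule indep_var_integrable[OF ind mX(1) mY(1)])
  have e: "(\<integral>\<omega>. (a \<bullet> X \<omega>) * (t \<bullet> Y \<omega>) \<partial>M) = 0"
    using indep_var_lebesgue_integral[OF ind mX(1) mY(1)] by (simp add: mX(2))
  show "integrable M (\<lambda>\<omega>. (t \<bullet> (B *v X \<omega> + Y \<omega>))\<^sup>2)"
    unfolding eq using mX(3) mY(3) i by simp
  have "(\<integral>\<omega>. (t \<bullet> (B *v X \<omega> + Y \<omega>))\<^sup>2 \<partial>M) = a \<bullet> (C *v a) + t \<bullet> (D *v t)"
    unfolding eq using mX(3,4) mY(3,4) i e by simp
  also have "\<dots> = t \<bullet> ((B ** C ** transpose B + D) *v t)"
    by (simp add: a_def inner_congruence matrix_vector_mult_add_rdistrib inner_add_right del: transpose_matrix_vector)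
  finally show "(\<integral>\<omega>. (t \<bullet> (B *v X \<omega> + Y \<omega>))\<^sup>2 \<partial>M) = t \<bullet> ((B ** C ** transpose B + D) *v t)" .
qed

section \<open>Lower bound for the error of low-rank estimators\<close>

lemma congruence_nth_diag: "(N ** C ** transpose N) $ i $ i = N $ i \<bullet> (C *v N $ i)"
  for N :: "real^'n^'m"
proof -
  have "(N ** C ** transpose N) $ i $ i = axis i 1 \<bullet> ((N ** C ** transpose N) *v axis i 1)"
    by (simp add: inner_axis' matrix_vector_mult_basis column_def)
  also have "\<dots> = (transpose N *v axis i 1) \<bullet> (C *v (transpose N *v axis i 1))"
    by (rule inner_congruence)
  also have "transpose N *v axis i 1 = N $ i"
    by (simp add: matrix_vector_mult_basis row_def vec_lambda_eta del: transpose_matrix_vector)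
  finally show ?thesis .
qed

text \<open>The value is the trace of \<open>N ** C ** transpose N\<close>; \<open>m\<close> enters
  only through its second moments.\<close>

lemma expectation_norm_sq:
  fixes N :: "real^'o^'n"
  assumes m: "\<And>t. integrable M (\<lambda>\<omega>. (t \<bullet> m \<omega>)\<^sup>2)"
    "\<And>t. (\<integral>\<omega>. (t \<bullet> m \<omega>)\<^sup>2 \<partial>M) = t \<bullet> (C *v t)"
  shows "integrable M (\<lambda>\<omega>. (N *v m \<omega>) \<bullet> (N *v m \<omega>))"
    and "(\<integral>\<omega>. (N *v m \<omega>) \<bullet> (N *v m \<omega>) \<partial>M) = (\<Sum>i\<in>UNIV. (N ** C ** transpose N) $ i $ i)"
proof -
  have eq: "(\<lambda>\<omega>. (N *v m \<omega>) \<bullet> (N *v m \<omega>)) = (\<lambda>\<omega>. \<Sum>i\<in>UNIV. (N $ i \<bullet> m \<omega>)\<^sup>2)"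
    by (simp add: inner_vec_def[of "N *v _"] matrix_vector_mul_component power2_eq_square)
  show "integrable M (\<lambda>\<omega>. (N *v m \<omega>) \<bullet> (N *v m \<omega>))"
    unfolding eq using m(1) by simp
  show "(\<integral>\<omega>. (N *v m \<omega>) \<bullet> (N *v m \<omega>) \<partial>M) = (\<Sum>i\<in>UNIV. (N ** C ** transpose N) $ i $ i)"
    unfolding eq using m by (simp add: congruence_nth_diag)
qed

text \<open>\<open>B\<close> cannot influence the components of the error along the kernel of
  \<open>transpose B\<close>, and by Bessel these bound the whole error from below.\<close>

lemma expectation_low_rank_error_ge:
  fixes F B :: "real^'o^'n"
  assumes m: "\<And>t. integrable M (\<lambda>\<omega>. (t \<bullet> m \<omega>)\<^sup>2)"
    "\<And>t. (\<integral>\<omega>. (t \<bullet> m \<omega>)\<^sup>2 \<partial>M) = t \<bullet> (C *v t)"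
    and F: "F ** C ** transpose F = diag_matrix d"
    and d: "\<And>i. 0 \<le> d $ i" "\<And>i j. i \<in> S \<Longrightarrow> j \<notin> S \<Longrightarrow> d $ j \<le> d $ i"
    and B: "rank B \<le> card S"
  shows "(\<Sum>j\<in>-S. d $ j) \<le> (\<integral>\<omega>. ((F - B) *v m \<omega>) \<bullet> ((F - B) *v m \<omega>) \<partial>M)"
proof -
  define K where "K = {x. transpose B *v x = 0}"
  have "subspace K"
    unfolding K_def by (auto simp: subspace_def matrix_vector_right_distrib
        matrix_vector_mult_scaleR simp del: transpose_matrix_vector)
  then obtain U where U: "U \<subseteq> K" "pairwise orthogonal U" "\<And>u. u \<in> U \<Longrightarrow> norm u = 1"
    "independent U" "card U = dim K"
    using orthonormal_basis_subspace by metis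
  have fU: "finite U" using U(4) by (rule independent_imp_finite)
  have "card U + rank B = CARD('n)"
    using dim_kernel[of "transpose B"] U(5) by (simp add: K_def rank_transpose)
  then have cardU: "CARD('n) \<le> card U + card S" using B by linarith
  have uB: "u \<bullet> (B *v x) = 0" if "u \<in> U" for u x
    using U(1) that transpose_mult_inner[of "transpose B" u x] by (auto simp: K_def)
  \<comment> \<open>\<open>c i\<close> is the squared length of the projection of the
    \<open>i\<close>-th unit vector to \<open>K\<close>: at most 1 by Bessel, with total
    \<open>card U\<close>, the trace of that projection.\<close>
  define c where "c = (\<lambda>i. \<Sum>u\<in>U. (u $ i)\<^sup>2)"
  have "(\<Sum>j\<in>-S. d $ j) \<le> (\<Sum>i\<in>UNIV. c i * d $ i)"
  proof (rule sum_le_weighted_sum)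
    show "c i \<le> 1" for i
      using bessel_inequality[OF fU U(2,3), of "axis i 1"] by (simp add: c_def inner_axis)
    have "sum c UNIV = (\<Sum>u\<in>U. u \<bullet> u)"
      unfolding c_def by (subst sum.swap) (simp add: inner_vec_def power2_eq_square)
    also have "\<dots> = card U" using U(3) by (simp add: norm_eq_1)
    finally show "real CARD('n) \<le> sum c UNIV + real (card S)" using cardU by simp
  qed (use d in \<open>auto simp: c_def sum_nonneg\<close>)
  also have "\<dots> = (\<Sum>u\<in>U. u \<bullet> (diag_matrix d *v u))"
    unfolding c_def inner_diag_matrix sum_distrib_right by (subst sum.swap) (simp add: mult.commute)
  also have "\<dots> = (\<Sum>u\<in>U. \<integral>\<omega>. ((transpose F *v u) \<bullet> m \<omega>)\<^sup>2 \<partial>M)"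
    unfolding m(2) by (simp add: inner_congruence flip: F del: transpose_matrix_vector)
  also have "\<dots> = (\<integral>\<omega>. (\<Sum>u\<in>U. ((transpose F *v u) \<bullet> m \<omega>)\<^sup>2) \<partial>M)"
    using m(1) by simp
  also have "\<dots> \<le> (\<integral>\<omega>. ((F - B) *v m \<omega>) \<bullet> ((F - B) *v m \<omega>) \<partial>M)"
  proof (rule integral_mono)
    fix \<omega>
    have "(transpose F *v u) \<bullet> m \<omega> = u \<bullet> ((F - B) *v m \<omega>)" if "u \<in> U" for u
      using uB[OF that] transpose_mult_inner[of "transpose F" u "m \<omega>"]
      by (simp add: matrix_vector_mult_diff_rdistrib inner_diff_right del: transpose_matrix_vector)
    then have "(\<Sum>u\<in>U. ((transpose F *v u) \<bullet> m \<omega>)\<^sup>2) = (\<Sum>u\<in>U. (u \<bullet> ((F - B) *v m \<omega>))\<^sup>2)"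
      by simp
    also have "\<dots> \<le> ((F - B) *v m \<omega>) \<bullet> ((F - B) *v m \<omega>)"
      by (rule bessel_inequality[OF fU U(2,3)])
    finally show "(\<Sum>u\<in>U. ((transpose F *v u) \<bullet> m \<omega>)\<^sup>2) \<le> ((F - B) *v m \<omega>) \<bullet> ((F - B) *v m \<omega>)" .
  next
    show "integrable M (\<lambda>\<omega>. ((F - B) *v m \<omega>) \<bullet> ((F - B) *v m \<omega>))"
      by (rule expectation_norm_sq(1)[OF m])
  qed (use m(1) in simp)
  finally show ?thesis .
qed

section \<open>Optimality of the OLR approximations\<close>

text \<open>The number of predecessors increases strictly with the index and is thus a bijection
  onto \<open>{..<CARD('n)}\<close>. Hence \<open>first_columns r\<close> keeps exactly
  \<open>r\<close> columns.\<close>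

lemma card_initial_segment:
  assumes "r \<le> CARD('n::{finite,linorder})"
  shows "card {j :: 'n. card {k. k < j} < r} = r"
proof -
  define h where "h = (\<lambda>j :: 'n. card {k. k < j})"
  have mono: "h i < h j" if "i < j" for i j
    unfolding h_def using that by (intro psubset_card_mono) auto
  then have inj: "inj h" by (metis injI less_irrefl linorder_neqE)
  have "h j < CARD('n)" for j
    unfolding h_def by (intro psubset_card_mono) auto
  then have "range h \<subseteq> {..<CARD('n)}" by auto
  moreover have "card (range h) = CARD('n)" using inj by (simp add: card_image)
  ultimately have "range h = {..<CARD('n)}" by (intro card_subset_eq) auto
  then have "h ` {j. h j < r} = {..<r}"
    using assms by (auto simp: set_eq_iff image_iff) (metis imageE lessThan_iff order_less_le_trans)
  then show ?thesis
    using card_image[OF inj_on_subset[OF inj subset_UNIV], of "{j. h j < r}"] by (simp add: h_def)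
qed

text \<open>\<open>olr_eigenbasis\<close> prescribes neither signs for \<open>d\<close> nor
  invertibility of \<open>W\<close>. The normalization yields both: \<open>d $ i\<close> is the
  value of a positive definite form on the nonzero column \<open>i\<close>, and
  \<open>transpose W ** H ** W\<close> is then invertible.\<close>

lemma olr_eigenbasis_diagonalizes:
  fixes W :: "real^('s::{finite,linorder})^('s::{finite,linorder})"
  assumes "olr_eigenbasis C G \<Gamma> W d" "pos_def C" "pos_def (transpose G ** matrix_inv \<Gamma> ** G)"
  shows "\<And>i. 0 < d $ i" "invertible W" "C = W ** diag_matrix d ** transpose W"
    and "transpose W ** (transpose G ** matrix_inv \<Gamma> ** G) ** W = diag_matrix d"
proof -
  define H where "H = transpose G ** matrix_inv \<Gamma> ** G"
  have nz: "\<And>i. column i W \<noteq> 0"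
    and eig: "H ** W = matrix_inv C ** W ** (diag_matrix d ** diag_matrix d)"
    and norm: "transpose W ** H ** W = diag_matrix d"
    using assms(1) unfolding olr_eigenbasis_def Let_def H_def by blast+
  have H: "pos_def H" using assms(3) by (simp add: H_def)
  show d: "0 < d $ i" for i
  proof -
    have "d $ i = (transpose W ** H ** transpose (transpose W)) $ i $ i" by (simp add: norm)
    also have "\<dots> = column i W \<bullet> (H *v column i W)"
      unfolding congruence_nth_diag by (simp add: transpose_def column_def)
    finally show ?thesis using H nz unfolding pos_def_def by metis
  qed
  then have dinv: "invertible (diag_matrix d)" by (intro invertible_diag_matrix) (metis less_irrefl)
  have "matrix_inv (diag_matrix d) ** transpose W ** H ** W = mat 1"
    using matrix_inv_inverse(2)[OF dinv] norm by (metis matrix_mul_assoc)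
  then show W: "invertible W" using invertible_left_inverse by blast
  \<comment> \<open>Insert the eigenvalue equation into the normalization; cancelling one factor
    \<open>diag_matrix d\<close> leaves a one-sided inverse, which identifies
    \<open>C\<close>.\<close>
  have "diag_matrix d = transpose W ** (matrix_inv C ** W ** (diag_matrix d ** diag_matrix d))"
    unfolding eig[symmetric] by (simp add: norm matrix_mul_assoc)
  then have "transpose W ** matrix_inv C ** W ** diag_matrix d ** diag_matrix d = diag_matrix d"
    by (simp add: matrix_mul_assoc)
  then have "transpose W ** (matrix_inv C ** W ** diag_matrix d) = mat 1"
    using matrix_inv_inverse(1)[OF dinv] by (metis matrix_mul_assoc matrix_mul_rid)
  then have "matrix_inv C ** W ** diag_matrix d ** transpose W = mat 1"
    using matrix_left_right_inverse by blast
  then have "matrix_inv (matrix_inv C) = W ** diag_matrix d ** transpose W"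
    by (intro matrix_inv_unique) (simp add: matrix_mul_assoc)
  then show "C = W ** diag_matrix d ** transpose W"
    using matrix_inv_matrix_inv[OF pos_def_invertible[OF assms(2)]] by simp
  show "transpose W ** (transpose G ** matrix_inv \<Gamma> ** G) ** W = diag_matrix d"
    using norm by (simp add: H_def)
qed

text \<open>The 0-1 diagonal factor is idempotent, so truncation joins the entrywise
  calculus.\<close>

lemma first_columns_eq:
  "first_columns r A = A ** diag_matrix (\<chi> j. if card {k. k < j} < r then 1 else 0)"
  by (simp add: vec_eq_iff first_columns_def diag_matrix_mult_right_nth)

text \<open>Precisions are diagonal in the dual basis \<open>V\<close>: the prior contributes
  \<open>1 / d $ i\<close>, the data \<open>d $ i\<close>, and truncation multiplies the data term
  by \<open>e $ i\<close>. So the OLR covariance is exact in the first \<open>r\<close> directions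
  and equals the prior in the others.\<close>

lemma olr_explicit:
  fixes W :: "real^('s::{finite,linorder})^('s::{finite,linorder})"
    and G :: "real^('s::{finite,linorder})^'o" and r :: nat
  assumes eig: "olr_eigenbasis C G \<Gamma> W d" and C: "pos_def C" and \<Gamma>: "pos_def \<Gamma>"
    and H: "pos_def (transpose G ** matrix_inv \<Gamma> ** G)"
  defines "V \<equiv> transpose (matrix_inv W)"
    and "e \<equiv> \<chi> j :: 's. if card {k. k < j} < r then 1 else 0"
  shows "posterior_cov C G \<Gamma> = W ** diag_matrix (\<chi> i. 1 / (1 / d $ i + d $ i)) ** transpose W"
    and "matrix_inv (posterior_cov C G \<Gamma>) = V ** diag_matrix (\<chi> i. 1 / d $ i + d $ i) ** transpose V"
    and "posterior_cov C (olr_forward r G \<Gamma> W d) \<Gamma>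
      = W ** diag_matrix (\<chi> i. 1 / (1 / d $ i + e $ i * d $ i)) ** transpose W"
    and "olr_forward r G \<Gamma> W d = G ** W ** diag_matrix e ** transpose V"
    and "transpose G ** matrix_inv \<Gamma> ** G = V ** diag_matrix d ** transpose V"
proof -
  note D = olr_eigenbasis_diagonalizes[OF eig C H]
  have d: "0 < d $ i" "d $ i \<noteq> 0" for i using D(1)[of i] by auto
  have VT: "transpose V = matrix_inv W" by (simp add: V_def)
  have cancel: "transpose V ** W = mat 1" "W ** transpose V = mat 1"
    "transpose W ** V = mat 1" "V ** transpose W = mat 1"
    by (simp_all add: VT matrix_inv_inverse[OF D(2)])
      (simp_all add: V_def transpose_matrix_inv_cancel[OF D(2)])
  have V: "invertible V" "transpose (matrix_inv V) = W" "matrix_inv V = transpose W"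
    using cancel matrix_inv_unique[OF cancel(4)] by (auto simp: invertible_def)
  have e: "e $ i * e $ i = e $ i" "0 \<le> e $ i" for i by (simp_all add: e_def)
  show Heq: "transpose G ** matrix_inv \<Gamma> ** G = V ** diag_matrix d ** transpose V"
  proof -
    have "transpose G ** matrix_inv \<Gamma> ** G
        = (V ** transpose W) ** (transpose G ** matrix_inv \<Gamma> ** G) ** (W ** transpose V)"
      by (simp add: cancel)
    also have "\<dots> = V ** (transpose W ** (transpose G ** matrix_inv \<Gamma> ** G) ** W) ** transpose V"
      by (simp only: matrix_mul_assoc)
    finally show ?thesis by (simp only: D(4))
  qed
  have Cinv: "matrix_inv C = V ** diag_matrix (\<chi> i. 1 / d $ i) ** transpose V"
    by (subst D(3)) (simp add: matrix_inv_diag_congruence[OF D(2) d(2)] V_def)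
  have inv: "matrix_inv (V ** diag_matrix f ** transpose V) = W ** diag_matrix (\<chi> i. 1 / f $ i) ** transpose W"
    if "\<And>i. f $ i \<noteq> 0" for f
    using matrix_inv_diag_congruence[OF V(1) that] by (simp add: V)
  have pos: "0 < 1 / d $ i + d $ i" for i using d(1)[of i] by (simp add: add_pos_pos)
  have pos': "0 < 1 / d $ i + e $ i * d $ i" for i
    using d(1)[of i] e(2)[of i] by (simp add: add_pos_nonneg)
  show post: "posterior_cov C G \<Gamma> = W ** diag_matrix (\<chi> i. 1 / (1 / d $ i + d $ i)) ** transpose W"
    unfolding posterior_cov_def Heq Cinv diag_congruence_add
    using pos by (subst inv) (auto simp: less_imp_neq[symmetric])
  show "matrix_inv (posterior_cov C G \<Gamma>) = V ** diag_matrix (\<chi> i. 1 / d $ i + d $ i) ** transpose V"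
    unfolding post using pos
    by (subst matrix_inv_diag_congruence[OF D(2)]) (auto simp: less_imp_neq[symmetric] V_def)
  \<comment> \<open>The matrix called \<open>V\<close> inside \<open>olr_forward\<close> coincides
    with the dual basis.\<close>
  have "V ** diag_matrix d ** transpose V ** W ** matrix_inv (diag_matrix d)
      = V ** (diag_matrix d ** (transpose V ** W) ** matrix_inv (diag_matrix d))"
    by (simp only: matrix_mul_assoc)
  also have "\<dots> = V"
    by (simp add: cancel matrix_inv_inverse(1) invertible_diag_matrix d(2))
  finally have "V ** diag_matrix d ** transpose V ** W ** matrix_inv (diag_matrix d) = V" .
  then have "olr_forward r G \<Gamma> W d = G ** (W ** diag_matrix e) ** transpose (V ** diag_matrix e)"
    by (simp add: olr_forward_def Let_def first_columns_eq Heq e_def)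
  also have "\<dots> = G ** W ** (diag_matrix e ** diag_matrix e) ** transpose V"
    by (simp add: matrix_transpose_mul matrix_mul_assoc)
  also have "diag_matrix e ** diag_matrix e = diag_matrix e"
    by (simp add: diag_matrix_mult e)
  finally show olr: "olr_forward r G \<Gamma> W d = G ** W ** diag_matrix e ** transpose V" .
  have "transpose (olr_forward r G \<Gamma> W d) ** matrix_inv \<Gamma> ** olr_forward r G \<Gamma> W d
      = V ** diag_matrix e ** (transpose W ** (transpose G ** matrix_inv \<Gamma> ** G) ** W) ** diag_matrix e ** transpose V"
    unfolding olr by (simp add: matrix_transpose_mul matrix_mul_assoc)
  also have "\<dots> = V ** (diag_matrix e ** diag_matrix d ** diag_matrix e) ** transpose V"
    unfolding D(4) by (simp add: matrix_mul_assoc)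
  also have "diag_matrix e ** diag_matrix d ** diag_matrix e = diag_matrix (\<chi> i. e $ i * d $ i)"
    using e(1) by (simp add: diag_matrix_mult vec_eq_iff) metis
  finally have HO: "transpose (olr_forward r G \<Gamma> W d) ** matrix_inv \<Gamma> ** olr_forward r G \<Gamma> W d
      = V ** diag_matrix (\<chi> i. e $ i * d $ i) ** transpose V" .
  show "posterior_cov C (olr_forward r G \<Gamma> W d) \<Gamma>
      = W ** diag_matrix (\<chi> i. 1 / (1 / d $ i + e $ i * d $ i)) ** transpose W"
    unfolding posterior_cov_def HO Cinv diag_congruence_add
    using pos' by (subst inv) (auto simp: less_imp_neq[symmetric])
qed

lemma olr_eigenvalue_order:
  assumes eig: "olr_eigenbasis C G \<Gamma> W d"
    and "card {k. k < i} < r" "\<not> card {k. k < j} < r"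
  shows "(d $ j)\<^sup>2 \<le> (d $ i)\<^sup>2"
proof -
  have "\<not> j \<le> i"
  proof
    assume "j \<le> i"
    then have "card {k. k < j} \<le> card {k. k < i}" by (intro card_mono) auto
    then show False using assms(2,3) by linarith
  qed
  then have "i \<le> j" by simp
  then show ?thesis using eig unfolding olr_eigenbasis_def Let_def by blast
qed

section \<open>Optimality of the OLR covariance and mean\<close>

lemma olr_covariance_optimal:
  fixes W :: "real^('s::{finite,linorder})^('s::{finite,linorder})"
    and G :: "real^('s::{finite,linorder})^'o"
  assumes eig: "olr_eigenbasis C G \<Gamma> W d" and C: "pos_def C" and \<Gamma>: "pos_def \<Gamma>"
    and H: "pos_def (transpose G ** matrix_inv \<Gamma> ** G)" and r: "r \<le> CARD('s)"
  shows "is_arg_min (foerstner_dist_sq (posterior_cov C G \<Gamma>)) (\<lambda>E. E \<in> cov_class r C)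
    (posterior_cov C (olr_forward r G \<Gamma> W d) \<Gamma>)"
proof -
  note D = olr_eigenbasis_diagonalizes[OF eig C H]
  note X = olr_explicit[OF eig C \<Gamma> H]
  define S where "S = {j :: 's. card {k. k < j} < r}"
  have S: "card S = r" unfolding S_def using r by (rule card_initial_segment)
  \<comment> \<open>\<open>T\<close> is a square root of the prior,
    \<open>C = T ** transpose T\<close>. Relative to it the posterior covariance has entries
    \<open>a\<close>, and the OLR covariance has entries \<open>b\<close>: those of \<open>a\<close>
    on \<open>S\<close> and the prior value 1 elsewhere.\<close>
  define T where "T = W ** diag_matrix (\<chi> i. sqrt (d $ i))"
  define a :: "real^('s::{finite,linorder})" where "a = (\<chi> i. 1 / (1 + (d $ i)\<^sup>2))"
  define b :: "real^('s::{finite,linorder})" where "b = (\<chi> i. if i \<in> S then a $ i else 1)"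
  have T: "invertible T"
    unfolding T_def using D(1,2) by (intro invertible_mult invertible_diag_matrix) (auto simp: less_imp_neq[symmetric])
  have T_congruence: "T ** diag_matrix f ** transpose T = W ** diag_matrix (\<chi> i. d $ i * f $ i) ** transpose W" for f
  proof -
    have "T ** diag_matrix f ** transpose T
        = W ** (diag_matrix (\<chi> i. sqrt (d $ i)) ** diag_matrix f ** diag_matrix (\<chi> i. sqrt (d $ i))) ** transpose W"
      by (simp add: T_def matrix_transpose_mul matrix_mul_assoc)
    also have "diag_matrix (\<chi> i. sqrt (d $ i)) ** diag_matrix f ** diag_matrix (\<chi> i. sqrt (d $ i)) = diag_matrix (\<chi> i. d $ i * f $ i)"
      using D(1) by (simp add: diag_matrix_mult vec_eq_iff less_imp_le)
    finally show ?thesis .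
  qed
  have CT: "C = T ** transpose T"
    using T_congruence[of "\<chi> i. 1"] D(3) by (simp add: diag_matrix_1)
  have a: "0 < a $ i" "a $ i < 1" for i
    using D(1)[of i] by (auto simp: a_def add_pos_nonneg)
  have b: "0 < b $ i" "b $ i \<le> 1" for i using a[of i] by (auto simp: b_def)
  have d_div: "1 / (1 / d $ i + d $ i) = d $ i * a $ i" for i
    using D(1)[of i] by (simp add: a_def field_simps power2_eq_square)
  have pos: "posterior_cov C G \<Gamma> = T ** diag_matrix a ** transpose T"
    unfolding X(1) T_congruence by (simp add: d_div)
  have olr: "posterior_cov C (olr_forward r G \<Gamma> W d) \<Gamma> = T ** diag_matrix b ** transpose T"
    unfolding X(3) T_congruence
    by (rule arg_cong[where f="\<lambda>v. W ** diag_matrix v ** transpose W"])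
      (simp add: vec_eq_iff b_def S_def d_div)
  have order: "a $ i \<le> a $ j" if "i \<in> S" "j \<notin> S" for i j
  proof -
    have "(d $ j)\<^sup>2 \<le> (d $ i)\<^sup>2"
      using that by (intro olr_eigenvalue_order[OF eig]) (auto simp: S_def)
    then show ?thesis by (simp add: a_def frac_le add_pos_nonneg)
  qed
  show ?thesis
    unfolding is_arg_min_def
  proof (intro conjI notI)
    \<comment> \<open>Membership witness: \<open>K ** transpose K\<close> has to be the prior minus
      the OLR covariance, with entries \<open>1 - b $ i\<close> relative to \<open>T\<close>. These
      vanish off \<open>S\<close>, which bounds the rank.\<close>
    define K where "K = T ** diag_matrix (\<chi> i. sqrt (1 - b $ i))"
    have "K ** transpose K
        = T ** (diag_matrix (\<chi> i. sqrt (1 - b $ i)) ** diag_matrix (\<chi> i. sqrt (1 - b $ i))) ** transpose T"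
      by (simp add: K_def matrix_transpose_mul matrix_mul_assoc)
    also have "diag_matrix (\<chi> i. sqrt (1 - b $ i)) ** diag_matrix (\<chi> i. sqrt (1 - b $ i)) = diag_matrix (\<chi> i. 1 - b $ i)"
      using b by (simp add: diag_matrix_mult)
    finally have "T ** diag_matrix b ** transpose T + K ** transpose K = C"
      by (simp add: diag_congruence_add diag_matrix_1 CT)
    then have "T ** diag_matrix b ** transpose T = C - K ** transpose K"
      by (simp add: eq_diff_eq)
    moreover have "rank K \<le> r"
    proof -
      have "rank K \<le> rank (diag_matrix (\<chi> i. sqrt (1 - b $ i)))"
        unfolding K_def by (rule rank_mul_le_right)
      also have "\<dots> \<le> card S" by (rule rank_diag_matrix_le) (simp add: b_def)
      finally show ?thesis by (simp add: S)
    qed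
    moreover have "pos_def (T ** diag_matrix b ** transpose T)"
      using b(1) T by (intro pos_def_congruence) (auto simp: pos_def_diag_matrix)
    ultimately show "posterior_cov C (olr_forward r G \<Gamma> W d) \<Gamma> \<in> cov_class r C"
      unfolding cov_class_def olr by force
  next
    assume "\<exists>E. E \<in> cov_class r C \<and> foerstner_dist_sq (posterior_cov C G \<Gamma>) E
      < foerstner_dist_sq (posterior_cov C G \<Gamma>) (posterior_cov C (olr_forward r G \<Gamma> W d) \<Gamma>)"
    then obtain E where E: "E \<in> cov_class (card S) (T ** transpose T)"
      and less: "foerstner_dist_sq (posterior_cov C G \<Gamma>) E
      < foerstner_dist_sq (posterior_cov C G \<Gamma>) (posterior_cov C (olr_forward r G \<Gamma> W d) \<Gamma>)"
      by (auto simp: S CT)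
    have "foerstner_dist_sq (posterior_cov C G \<Gamma>) (posterior_cov C (olr_forward r G \<Gamma> W d) \<Gamma>)
        = (\<Sum>i\<in>UNIV. (ln (a $ i / b $ i))\<^sup>2)"
      unfolding pos olr foerstner_dist_sq_congruence[OF T]
      using b(1) by (intro foerstner_dist_sq_diag) (auto simp: less_imp_neq[symmetric])
    \<comment> \<open>On \<open>S\<close> the quotient is 1 and its logarithm 0; elsewhere
      \<open>b $ i = 1\<close>.\<close>
    also have "\<dots> = (\<Sum>i\<in>-S. (ln (a $ i))\<^sup>2)"
      using a(1) by (intro sum.mono_neutral_cong_right) (auto simp: b_def less_imp_neq[symmetric])
    also have "\<dots> \<le> foerstner_dist_sq (posterior_cov C G \<Gamma>) E"
      unfolding pos by (rule foerstner_dist_sq_lower_bound_cov_class[OF T E a order])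
    finally show False using less by simp
  qed
qed

text \<open>With \<open>N\<close> a square root of the posterior precision, the objective at
  \<open>B *v m\<close> is the expected squared length of \<open>(F - N ** B) *v m\<close>. The
  whitened exact mean \<open>F *v m\<close> has second-moment matrix \<open>diag_matrix d2\<close>,
  and OLR keeps its first \<open>r\<close> components.\<close>

lemma olr_mean_optimal:
  fixes W :: "real^('s::{finite,linorder})^('s::{finite,linorder})"
    and G :: "real^('s::{finite,linorder})^'o" and m :: "'w \<Rightarrow> real^'o"
  assumes eig: "olr_eigenbasis C G \<Gamma> W d" and C: "pos_def C" and \<Gamma>: "pos_def \<Gamma>"
    and H: "pos_def (transpose G ** matrix_inv \<Gamma> ** G)" and r: "r \<le> CARD('s)"
    and m: "\<And>t. integrable M (\<lambda>\<omega>. (t \<bullet> m \<omega>)\<^sup>2)"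
      "\<And>t. (\<integral>\<omega>. (t \<bullet> m \<omega>)\<^sup>2 \<partial>M) = t \<bullet> ((G ** C ** transpose G + \<Gamma>) *v t)"
  shows "is_arg_min
    (\<lambda>\<mu>. \<integral>\<omega>. weighted_norm_sq (matrix_inv (posterior_cov C G \<Gamma>)) (posterior_mean C G \<Gamma> (m \<omega>) - \<mu> \<omega>) \<partial>M)
    (\<lambda>\<mu>. \<mu> \<in> mean_class r m)
    (\<lambda>\<omega>. posterior_mean C (olr_forward r G \<Gamma> W d) \<Gamma> (m \<omega>))"
proof -
  note D = olr_eigenbasis_diagonalizes[OF eig C H]
  note X = olr_explicit[OF eig C \<Gamma> H]
  define V where "V = transpose (matrix_inv W)"
  have cancel: "transpose V ** W = mat 1" "transpose W ** V = mat 1"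
    by (simp_all add: V_def matrix_inv_inverse[OF D(2)] transpose_matrix_inv_cancel[OF D(2)])
  define e :: "real^('s::{finite,linorder})" where "e = (\<chi> j. if card {k. k < j} < r then 1 else 0)"
  define S where "S = {j :: 's. card {k. k < j} < r}"
  have S: "card S = r" unfolding S_def using r by (rule card_initial_segment)
  have eS: "e $ i = (if i \<in> S then 1 else 0)" for i by (simp add: e_def S_def)
  define f where "f = (\<chi> i. 1 / d $ i + d $ i)"
  have f: "0 < f $ i" for i using D(1)[of i] by (simp add: f_def add_pos_pos)
  have d: "d $ i \<noteq> 0" for i using D(1)[of i] by simp
  \<comment> \<open>\<open>\<Psi>\<close> takes the data to eigenbasis coordinates and is common to
    both means; they differ only in the diagonal factor that follows.\<close>
  define \<Psi> where "\<Psi> = transpose W ** transpose G ** matrix_inv \<Gamma>"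
  define A where "A = W ** diag_matrix (\<chi> i. 1 / f $ i) ** \<Psi>"
  define Ao where "Ao = W ** diag_matrix (\<chi> i. e $ i / f $ i) ** \<Psi>"
  have mean: "posterior_mean C G \<Gamma> x = A *v x" for x
    unfolding posterior_mean_def X(1) A_def \<Psi>_def f_def by (simp add: matrix_mul_assoc)
  have mean_olr: "posterior_mean C (olr_forward r G \<Gamma> W d) \<Gamma> x = Ao *v x" for x
  proof -
    have "posterior_cov C (olr_forward r G \<Gamma> W d) \<Gamma> ** transpose (olr_forward r G \<Gamma> W d) ** matrix_inv \<Gamma>
        = W ** diag_matrix (\<chi> i. 1 / (1 / d $ i + e $ i * d $ i)) ** (transpose W ** V) ** diag_matrix e ** \<Psi>"
      unfolding X(3) unfolding X(4) \<Psi>_def by (simp add: V_def e_def matrix_transpose_mul matrix_mul_assoc)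
    also have "\<dots> = W ** (diag_matrix (\<chi> i. 1 / (1 / d $ i + e $ i * d $ i)) ** diag_matrix e) ** \<Psi>"
      by (simp add: cancel matrix_mul_assoc)
    also have "diag_matrix (\<chi> i. 1 / (1 / d $ i + e $ i * d $ i)) ** diag_matrix e = diag_matrix (\<chi> i. e $ i / f $ i)"
      by (simp add: diag_matrix_mult vec_eq_iff eS f_def)
    finally show ?thesis by (simp add: posterior_mean_def Ao_def)
  qed
  define N where "N = diag_matrix (\<chi> i. sqrt (f $ i)) ** transpose V"
  have NN: "weighted_norm_sq (matrix_inv (posterior_cov C G \<Gamma>)) x = (N *v x) \<bullet> (N *v x)" for x
  proof -
    have "diag_matrix (\<chi> i. sqrt (f $ i)) ** diag_matrix (\<chi> i. sqrt (f $ i)) = diag_matrix f"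
      using f by (simp add: diag_matrix_mult less_imp_le)
    then have "V ** diag_matrix f ** transpose V
        = V ** (diag_matrix (\<chi> i. sqrt (f $ i)) ** diag_matrix (\<chi> i. sqrt (f $ i))) ** transpose V"
      by simp
    also have "\<dots> = transpose N ** N"
      by (simp add: N_def matrix_transpose_mul matrix_mul_assoc)
    finally have "V ** diag_matrix f ** transpose V = transpose N ** N" .
    then have "matrix_inv (posterior_cov C G \<Gamma>) = transpose N ** N"
      unfolding X(2) f_def V_def by simp
    then show ?thesis
      by (simp add: weighted_norm_sq_def transpose_mult_inner matrix_vector_mul_assoc
          del: transpose_matrix_vector)
  qed
  define F where "F = N ** A"
  have F_eq: "F = diag_matrix (\<chi> i. 1 / sqrt (f $ i)) ** \<Psi>"
  proof -
    have "F = diag_matrix (\<chi> i. sqrt (f $ i)) ** (transpose V ** W) ** diag_matrix (\<chi> i. 1 / f $ i) ** \<Psi>"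
      by (simp add: F_def N_def A_def matrix_mul_assoc)
    also have "\<dots> = (diag_matrix (\<chi> i. sqrt (f $ i)) ** diag_matrix (\<chi> i. 1 / f $ i)) ** \<Psi>"
      by (simp add: cancel)
    also have "diag_matrix (\<chi> i. sqrt (f $ i)) ** diag_matrix (\<chi> i. 1 / f $ i) = diag_matrix (\<chi> i. 1 / sqrt (f $ i))"
      using f by (simp add: diag_matrix_mult vec_eq_iff divide_simps less_imp_le)
    finally show ?thesis .
  qed
  \<comment> \<open>After whitening, the OLR estimator is the exact one followed by the coordinate
    projection \<open>e\<close>.\<close>
  have NAo: "N ** Ao = diag_matrix e ** F"
  proof -
    have "N ** Ao = diag_matrix (\<chi> i. sqrt (f $ i)) ** (transpose V ** W) ** diag_matrix (\<chi> i. e $ i / f $ i) ** \<Psi>"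
      by (simp add: N_def Ao_def matrix_mul_assoc)
    also have "\<dots> = (diag_matrix (\<chi> i. sqrt (f $ i)) ** diag_matrix (\<chi> i. e $ i / f $ i)) ** \<Psi>"
      by (simp add: cancel)
    also have "diag_matrix (\<chi> i. sqrt (f $ i)) ** diag_matrix (\<chi> i. e $ i / f $ i)
        = diag_matrix e ** diag_matrix (\<chi> i. 1 / sqrt (f $ i))"
      using f by (simp add: diag_matrix_mult vec_eq_iff divide_simps less_imp_le)
    finally show ?thesis by (simp add: F_eq matrix_mul_assoc)
  qed
  define \<Gamma>m where "\<Gamma>m = G ** C ** transpose G + \<Gamma>"
  define d2 where "d2 = (\<chi> i. (d $ i)\<^sup>2)"
  \<comment> \<open>The signal part of \<open>\<Gamma>m\<close> contributes
    \<open>diag_matrix d\<close> three times, hence the cube; the noise part contributes it once,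
    because \<open>matrix_inv \<Gamma>\<close> cancels \<open>\<Gamma>\<close>.\<close>
  have \<Psi>_cov: "\<Psi> ** \<Gamma>m ** transpose \<Psi> = diag_matrix (\<chi> i. d $ i ^ 3 + d $ i)"
  proof -
    note \<Gamma>i = pos_def_invertible[OF \<Gamma>]
    have sym: "transpose (matrix_inv \<Gamma>) = matrix_inv \<Gamma>"
      using matrix_inv_transpose[OF \<Gamma>i] \<Gamma> by (simp add: pos_def_def)
    have T\<Psi>: "transpose \<Psi> = matrix_inv \<Gamma> ** G ** W"
      by (simp add: \<Psi>_def matrix_transpose_mul sym matrix_mul_assoc)
    have \<Psi>GW: "\<Psi> ** G ** W = diag_matrix d"
      using D(4) by (simp add: \<Psi>_def matrix_mul_assoc)
    have GT\<Psi>: "transpose W ** transpose G ** transpose \<Psi> = diag_matrix d"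
      using D(4) by (simp add: T\<Psi> matrix_mul_assoc)
    have "\<Psi> ** \<Gamma> ** transpose \<Psi> = transpose W ** transpose G ** (matrix_inv \<Gamma> ** \<Gamma>) ** matrix_inv \<Gamma> ** G ** W"
      by (simp only: \<Psi>_def T\<Psi>[unfolded \<Psi>_def] matrix_mul_assoc)
    then have "\<Psi> ** \<Gamma> ** transpose \<Psi> = diag_matrix d"
      using D(4) by (simp add: matrix_inv_inverse[OF \<Gamma>i] matrix_mul_assoc)
    moreover have "\<Psi> ** (G ** C ** transpose G) ** transpose \<Psi>
        = (\<Psi> ** G ** W) ** diag_matrix d ** (transpose W ** transpose G ** transpose \<Psi>)"
      by (subst D(3)) (simp only: matrix_mul_assoc)
    ultimately show ?thesis
      unfolding \<Gamma>m_def matrix_add_ldistrib matrix_add_rdistrib \<Psi>GW GT\<Psi>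
      by (simp add: diag_matrix_mult diag_matrix_add power3_eq_cube)
  qed
  have F_cov: "F ** \<Gamma>m ** transpose F = diag_matrix d2"
  proof -
    \<comment> \<open>\<open>f $ i\<close> equals \<open>(1 + (d $ i)\<^sup>2) / d $ i\<close>, so
      whitening leaves exactly the squared eigenvalue.\<close>
    have quotient: "(d $ i ^ 3 + d $ i) / f $ i = (d $ i)\<^sup>2" for i
    proof -
      have "d $ i ^ 3 + d $ i = (d $ i)\<^sup>2 * f $ i"
        using d[of i] by (simp add: f_def power2_eq_square power3_eq_cube algebra_simps)
      then show ?thesis using f[of i] by simp
    qed
    have "F ** \<Gamma>m ** transpose F = diag_matrix (\<chi> i. 1 / sqrt (f $ i)) ** (\<Psi> ** \<Gamma>m ** transpose \<Psi>)
        ** diag_matrix (\<chi> i. 1 / sqrt (f $ i))"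
      unfolding F_eq by (simp add: matrix_transpose_mul matrix_mul_assoc)
    also have "\<dots> = diag_matrix (\<chi> i. (d $ i ^ 3 + d $ i) / f $ i)"
      using f by (simp add: \<Psi>_cov diag_matrix_mult vec_eq_iff divide_simps less_imp_le)
    also have "\<dots> = diag_matrix d2"
      by (simp add: d2_def vec_eq_iff quotient)
    finally show ?thesis .
  qed
  note m' = m[folded \<Gamma>m_def]
  have objective: "weighted_norm_sq (matrix_inv (posterior_cov C G \<Gamma>)) (posterior_mean C G \<Gamma> (m \<omega>) - B *v m \<omega>)
      = ((F - N ** B) *v m \<omega>) \<bullet> ((F - N ** B) *v m \<omega>)" for B \<omega>
    unfolding NN mean F_def
    by (simp add: matrix_vector_mult_diff_distrib matrix_vector_mult_diff_rdistrib matrix_vector_mul_assoc)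
  show ?thesis
    unfolding is_arg_min_def
  proof (intro conjI notI)
    have "rank Ao \<le> rank (diag_matrix (\<chi> i. e $ i / f $ i))"
      unfolding Ao_def by (rule order_trans[OF rank_mul_le_left rank_mul_le_right])
    also have "\<dots> \<le> card S" by (rule rank_diag_matrix_le) (simp add: eS)
    finally show "(\<lambda>\<omega>. posterior_mean C (olr_forward r G \<Gamma> W d) \<Gamma> (m \<omega>)) \<in> mean_class r m"
      unfolding mean_class_def mean_olr S by blast
  next
    assume "\<exists>\<mu>. \<mu> \<in> mean_class r m \<and>
      (\<integral>\<omega>. weighted_norm_sq (matrix_inv (posterior_cov C G \<Gamma>)) (posterior_mean C G \<Gamma> (m \<omega>) - \<mu> \<omega>) \<partial>M)
      < (\<integral>\<omega>. weighted_norm_sq (matrix_inv (posterior_cov C G \<Gamma>))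
          (posterior_mean C G \<Gamma> (m \<omega>) - posterior_mean C (olr_forward r G \<Gamma> W d) \<Gamma> (m \<omega>)) \<partial>M)"
    then obtain B :: "real^'o^('s::{finite,linorder})" where B: "rank B \<le> r"
      and less: "(\<integral>\<omega>. ((F - N ** B) *v m \<omega>) \<bullet> ((F - N ** B) *v m \<omega>) \<partial>M)
        < (\<integral>\<omega>. ((F - N ** Ao) *v m \<omega>) \<bullet> ((F - N ** Ao) *v m \<omega>) \<partial>M)"
      unfolding mean_class_def mean_olr by (auto simp: objective)
    \<comment> \<open>The OLR residual consists of the components outside \<open>S\<close>, so its
      error equals the lower bound for rank \<open>r\<close>.\<close>
    have FAo: "F - N ** Ao = diag_matrix (\<chi> i. 1 - e $ i) ** F"
      using matrix_diff_rdistrib[of "mat 1" "diag_matrix e" F] diag_matrix_diff[of "\<chi> i. 1" e]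
      by (simp add: NAo diag_matrix_1)
    have "(F - N ** Ao) ** \<Gamma>m ** transpose (F - N ** Ao)
        = diag_matrix (\<chi> i. 1 - e $ i) ** (F ** \<Gamma>m ** transpose F) ** diag_matrix (\<chi> i. 1 - e $ i)"
      unfolding FAo by (simp add: matrix_transpose_mul matrix_mul_assoc)
    then have "(\<integral>\<omega>. ((F - N ** Ao) *v m \<omega>) \<bullet> ((F - N ** Ao) *v m \<omega>) \<partial>M)
        = (\<Sum>i\<in>UNIV. (1 - e $ i) * d2 $ i * (1 - e $ i))"
      unfolding expectation_norm_sq(2)[OF m'] by (simp add: F_cov diag_matrix_mult)
    also have "\<dots> = (\<Sum>i\<in>-S. d2 $ i)"
      by (intro sum.mono_neutral_cong_right) (auto simp: eS)
    also have "\<dots> \<le> (\<integral>\<omega>. ((F - N ** B) *v m \<omega>) \<bullet> ((F - N ** B) *v m \<omega>) \<partial>M)"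
    proof (rule expectation_low_rank_error_ge[OF m' F_cov])
      show "rank (N ** B) \<le> card S"
        using rank_mul_le_right[of N B] B S by linarith
      show "d2 $ j \<le> d2 $ i" if "i \<in> S" "j \<notin> S" for i j
      proof -
        have "(d $ j)\<^sup>2 \<le> (d $ i)\<^sup>2"
          using that by (intro olr_eigenvalue_order[OF eig]) (auto simp: S_def)
        then show ?thesis by (simp add: d2_def)
      qed
    qed (simp add: d2_def)
    finally show False using less by simp
  qed
qed

section \<open>Restriction by square-root balancing\<close>

text \<open>Both products are Gram matrices, of \<open>transpose L ** V = Z ** diag_matrix q\<close>
  and \<open>transpose R ** W = U ** diag_matrix q\<close> with \<open>q\<close> the square roots of
  \<open>\<sigma>\<close>; the orthonormal columns of \<open>Z\<close> and \<open>U\<close> drop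
  out.\<close>

lemma balanced_restriction:
  fixes L :: "real^('s::{finite,linorder})^'d" and R :: "real^'k^'d"
  assumes svd: "thin_svd (transpose R ** L) U \<sigma> Z"
    and W: "W = L ** Z ** inv_sqrt_diag \<sigma>" and V: "V = R ** U ** inv_sqrt_diag \<sigma>"
  shows "transpose V ** (L ** transpose L) ** V = diag_matrix \<sigma>"
    and "transpose W ** (R ** transpose R) ** W = diag_matrix \<sigma>"
proof -
  have A: "transpose R ** L = U ** diag_matrix \<sigma> ** transpose Z"
    and U: "transpose U ** U = mat 1" and Z: "transpose Z ** Z = mat 1" and \<sigma>: "\<And>i. 0 < \<sigma> $ i"
    using svd by (auto simp: thin_svd_def)
  define q where "q = (\<chi> i. sqrt (\<sigma> $ i))"
  have q: "diag_matrix \<sigma> ** inv_sqrt_diag \<sigma> = diag_matrix q" "diag_matrix q ** diag_matrix q = diag_matrix \<sigma>"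
    using \<sigma> by (auto simp: inv_sqrt_diag_def q_def diag_matrix_mult vec_eq_iff divide_simps less_imp_le)
  have "transpose L ** V = transpose (transpose R ** L) ** U ** inv_sqrt_diag \<sigma>"
    by (simp add: V matrix_transpose_mul matrix_mul_assoc)
  also have "\<dots> = Z ** diag_matrix \<sigma> ** (transpose U ** U) ** inv_sqrt_diag \<sigma>"
    by (simp add: A matrix_transpose_mul matrix_mul_assoc)
  finally have LV: "transpose L ** V = Z ** diag_matrix q"
    by (simp add: U q(1) flip: matrix_mul_assoc)
  have "transpose V ** (L ** transpose L) ** V = transpose (transpose L ** V) ** (transpose L ** V)"
    by (simp add: matrix_transpose_mul matrix_mul_assoc)
  also have "\<dots> = diag_matrix q ** (transpose Z ** Z) ** diag_matrix q"
    unfolding LV by (simp add: matrix_transpose_mul matrix_mul_assoc)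
  finally show "transpose V ** (L ** transpose L) ** V = diag_matrix \<sigma>"
    by (simp add: Z q)
  have "transpose R ** W = (transpose R ** L) ** Z ** inv_sqrt_diag \<sigma>"
    by (simp add: W matrix_mul_assoc)
  also have "\<dots> = U ** diag_matrix \<sigma> ** (transpose Z ** Z) ** inv_sqrt_diag \<sigma>"
    by (simp add: A matrix_mul_assoc)
  finally have RW: "transpose R ** W = U ** diag_matrix q"
    by (simp add: Z q(1) flip: matrix_mul_assoc)
  have "transpose W ** (R ** transpose R) ** W = transpose (transpose R ** W) ** (transpose R ** W)"
    by (simp add: matrix_transpose_mul matrix_mul_assoc)
  also have "\<dots> = diag_matrix q ** (transpose U ** U) ** diag_matrix q"
    unfolding RW by (simp add: matrix_transpose_mul matrix_mul_assoc)
  finally show "transpose W ** (R ** transpose R) ** W = diag_matrix \<sigma>"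
    by (simp add: U q)
qed

theorem corollary3p1:
  fixes M :: "'w measure"
    and p :: "'w \<Rightarrow> real^'d" and eps :: "'w \<Rightarrow> real^'o"
    and G :: "real^'d^'o" and \<Gamma>obs :: "real^'o^'o" and \<Gamma>pr Q :: "real^'d^'d"
    and L :: "real^('s::{finite,linorder})^'d" and R :: "real^'k^'d"
    and U :: "real^('s::{finite,linorder})^'k" and Z :: "real^('s::{finite,linorder})^('s::{finite,linorder})"
    and \<sigma> :: "real^('s::{finite,linorder})"
    and W V :: "real^('s::{finite,linorder})^'d"
    and Gh Golr :: "real^('s::{finite,linorder})^'o"
    and \<Gamma>prh :: "real^('s::{finite,linorder})^('s::{finite,linorder})"
    and ph :: "'w \<Rightarrow> real^('s::{finite,linorder})" and m :: "'w \<Rightarrow> real^'o"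
    and Wh :: "real^('s::{finite,linorder})^('s::{finite,linorder})"
    and \<sigma>h :: "real^('s::{finite,linorder})"
    and \<Gamma>pos \<Gamma>olr :: "real^('s::{finite,linorder})^('s::{finite,linorder})"
    and \<mu>pos \<mu>olr :: "'w \<Rightarrow> real^('s::{finite,linorder})"
    and r :: nat
  assumes "prob_space M"
    and "pos_def \<Gamma>obs"
    and "pos_semidef \<Gamma>pr" and "rank \<Gamma>pr = CARD('s)" and "CARD('s) < CARD('d)"
    and "gaussian_vector M p \<Gamma>pr" and "gaussian_vector M eps \<Gamma>obs"
    and "indep_vectors M p eps"
    and "Q = transpose G ** matrix_inv \<Gamma>obs ** G" and "rank Q = CARD('d)"
    and "\<Gamma>pr = L ** transpose L" and "Q = R ** transpose R"
    and "thin_svd (transpose R ** L) U \<sigma> Z"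
    and "W = L ** Z ** inv_sqrt_diag \<sigma>" and "V = R ** U ** inv_sqrt_diag \<sigma>"
    and "Gh = G ** W" and "\<Gamma>prh = transpose V ** \<Gamma>pr ** V"
    and "ph = (\<lambda>\<omega>. transpose V *v p \<omega>)"
    and "m = (\<lambda>\<omega>. Gh *v ph \<omega> + eps \<omega>)"
    and "\<Gamma>pos = posterior_cov \<Gamma>prh Gh \<Gamma>obs"
    and "\<mu>pos = (\<lambda>\<omega>. posterior_mean \<Gamma>prh Gh \<Gamma>obs (m \<omega>))"
    and "r \<le> CARD('s)"
    and "olr_eigenbasis \<Gamma>prh Gh \<Gamma>obs Wh \<sigma>h"
    and "Golr = olr_forward r Gh \<Gamma>obs Wh \<sigma>h"
    and "\<Gamma>olr = posterior_cov \<Gamma>prh Golr \<Gamma>obs"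
    and "\<mu>olr = (\<lambda>\<omega>. posterior_mean \<Gamma>prh Golr \<Gamma>obs (m \<omega>))"
  shows "is_arg_min (\<lambda>\<Gamma>. foerstner_dist_sq \<Gamma>pos \<Gamma>) (\<lambda>\<Gamma>. \<Gamma> \<in> cov_class r \<Gamma>prh) \<Gamma>olr \<and>
    is_arg_min
      (\<lambda>\<mu>. prob_space.expectation M
               (\<lambda>\<omega>. weighted_norm_sq (matrix_inv \<Gamma>pos) (\<mu>pos \<omega> - \<mu> \<omega>)))
      (\<lambda>\<mu>. \<mu> \<in> mean_class r m) \<mu>olr"
proof -
  note svd = assms(13) and W = assms(14) and V = assms(15) and eig = assms(23)
  have prh: "\<Gamma>prh = diag_matrix \<sigma>"
    using balanced_restriction(1)[OF svd W V] assms(11,17) by simp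
  have H: "transpose Gh ** matrix_inv \<Gamma>obs ** Gh = diag_matrix \<sigma>"
  proof -
    have "transpose W ** Q ** W = diag_matrix \<sigma>"
      unfolding assms(12) by (rule balanced_restriction(2)[OF svd W V])
    then show ?thesis
      unfolding assms(9,16) by (simp add: matrix_transpose_mul matrix_mul_assoc)
  qed
  have \<sigma>: "pos_def (diag_matrix \<sigma>)"
    using svd by (simp add: thin_svd_def pos_def_diag_matrix)
  \<comment> \<open>Restriction restores the positive definiteness that \<open>\<Gamma>pr\<close>,
    of rank below \<open>CARD('d)\<close>, lacks, so the optimality lemmas apply.\<close>
  have C: "pos_def \<Gamma>prh" and H_pos: "pos_def (transpose Gh ** matrix_inv \<Gamma>obs ** Gh)"
    using \<sigma> by (simp_all add: prh H)
  \<comment> \<open>Written as a linear image of \<open>p\<close> plus noise, the data fit the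
    assumed independence of \<open>p\<close> and \<open>eps\<close>; \<open>cov\<close> identifies
    their second moments with those of the restricted model.\<close>
  have m: "m = (\<lambda>\<omega>. (Gh ** transpose V) *v p \<omega> + eps \<omega>)"
    unfolding assms(18,19) by (simp add: matrix_vector_mul_assoc del: transpose_matrix_vector)
  have cov: "(Gh ** transpose V) ** \<Gamma>pr ** transpose (Gh ** transpose V) + \<Gamma>obs
      = Gh ** \<Gamma>prh ** transpose Gh + \<Gamma>obs"
    by (simp add: assms(17) matrix_transpose_mul matrix_mul_assoc)
  have moments: "integrable M (\<lambda>\<omega>. (t \<bullet> m \<omega>)\<^sup>2)"
    "(\<integral>\<omega>. (t \<bullet> m \<omega>)\<^sup>2 \<partial>M) = t \<bullet> ((Gh ** \<Gamma>prh ** transpose Gh + \<Gamma>obs) *v t)" for t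
    using linear_model_second_moment[OF assms(1,6-8), of t "Gh ** transpose V"]
    by (simp_all only: m cov)
  have "is_arg_min (foerstner_dist_sq \<Gamma>pos) (\<lambda>E. E \<in> cov_class r \<Gamma>prh) \<Gamma>olr"
    unfolding assms(20,24,25)
    by (rule olr_covariance_optimal[OF eig C assms(2) H_pos assms(22)])
  moreover have "is_arg_min
      (\<lambda>\<mu>. \<integral>\<omega>. weighted_norm_sq (matrix_inv \<Gamma>pos) (\<mu>pos \<omega> - \<mu> \<omega>) \<partial>M)
      (\<lambda>\<mu>. \<mu> \<in> mean_class r m) \<mu>olr"
    unfolding assms(20,21,24,26)
    by (rule olr_mean_optimal[OF eig C assms(2) H_pos assms(22) moments])
  ultimately show ?thesis ..
qed

end
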